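(* Consider a rectilinear shock wave $x_1=0$ in two-dimensional compressible isentropic elastodynamics (a piecewise constant background solution as described in the context, with downstream Mach number $M$, upstream Mach number $M_-$, density ratio $R=\hat\rho^+/\hat\rho^-$ and scaled downstream deformation gradient $\mathcal{F}=(\mathcal{F}_{ij})_{i,j=1,2}$). Assume that the Lax conditions hold: $$M_->\frac{M}{\sqrt{M^2-M_1^2}},\qquad M_1<M<M_*,$$ where $M_1=\sqrt{\mathcal{F}_{11}^2+\mathcal{F}_{12}^2}$ and $M_*=\sqrt{1+\mathcal{F}_{11}^2+\mathcal{F}_{12}^2}$. Then this shock wave is uniformly stable if and only if $$ \begin{split} \big(1+&\mathcal{F}_{11}^2+\mathcal{F}_{12}^2+M^2\big)\left(1+(\mathcal{F}:\mathcal{F})+(\det \mathcal{F})^2\right) \\ & -\left\{R(M^2-\mathcal{F}_{11}^2-\mathcal{F}_{12}^2)+\mathcal{F}_{21}^2+\mathcal{F}_{22}^2 \right\}\left(1+\mathcal{F}_{11}^2+\mathcal{F}_{12}^2\right)^2 \\ & +\left(\mathcal{F}_{11}\mathcal{F}_{21}+\mathcal{F}_{12}\mathcal{F}_{22}\right)^2\left\{2(1+\mathcal{F}_{11}^2+\mathcal{F}_{12}^2)-M^2\right\} \\ & \qquad >2M\left|\mathcal{F}_{11}\mathcal{F}_{21}+\mathcal{F}_{12}\mathcal{F}_{22}\right|\sqrt{\left(1+\mathcal{F}_{11}^2+\mathcal{F}_{12}^2-M^2\right)\left(1+(\mathcal{F}:\mathcal{F})+(\det \mathcal{F})^2\right)}\,,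 \end{split} $$ where $\mathcal{F}:\mathcal{F}=\sum_{i,j}\mathcal{F}_{ij}^2$. If this inequality is violated, then the shock wave is weakly stable.
   Context: **Equations.** The 2D isentropic elastodynamics system (Hookean linear elasticity) is $$\partial_t\rho+\mathrm{div}(\rho v)=0,\quad \partial_t(\rho v)+\mathrm{div}(\rho v\otimes v)+\nabla p-\mathrm{div}(\rho FF^\top)=0,\quad \partial_t(\rho F_j)+\mathrm{div}(\rho F_j\otimes v-v\otimes\rho F_j)=0\ (j=1,2),$$ with density $\rho$, velocity $v\in\mathbb{R}^2$, deformation gradient $F=(F_{ij})_{i,j=1,2}$ with columns $F_1=(F_{11},F_{21})$, $F_2=(F_{12},F_{22})$, and pressure $p$. The density is a smooth function $\rho=\rho(p)$ with $\rho>0$, $\rho'(p)>0$, and the sound speed is $c=1/\sqrt{\rho'(p)}$. **Background rectilinear shock.** Constant states $(\hat p^\pm,\hat v^\pm,\widehat F^\pm)$ in $\{\pm x_1>0\}$, with $\hat\rho^\pm=\rho(\hat p^\pm)>0$, $\hat c^\pm=1/\sqrt{\rho'(\hat p^\pm)}>0$, $\hat\rho^+\ne\hat\rho^-$, $\hat v_1^\pm>0$, $\hat v_2^+=\hat v_2^-=0$ (a choice of reference frame), satisfying the jump conditions $$\frac{\hat\rho^+}{\hat\rho^-}=\frac{\hat v_1^-}{\hat v_1^+},\qquad \frac{\hat\rho^+}{\hat\rho^-}\big\{(\hat v_1^+)^2-(\widehat F_{11}^+)^2-(\widehat F_{12}^+)^2\big\}(\hat\rho^+-\hat\rho^-)=\hat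 p^+-\hat p^-,$$ $$\widehat F_{2j}^+=\widehat F_{2j}^-,\qquad \hat\rho^+\widehat F_{1j}^+=\hat\rho^-\widehat F_{1j}^-\qquad (j=1,2).$$ The "+" side is downstream (behind the shock). Put $M=\hat v_1^+/\hat c^+$, $M_-=\hat v_1^-/\hat c^-$, $R=\hat\rho^+/\hat\rho^-$, $\mathcal{F}_{ij}=\widehat F_{ij}^+/\hat c^+$, and $$\ell_0=\mathcal{F}_{11}\mathcal{F}_{21}+\mathcal{F}_{12}\mathcal{F}_{22},\quad d_0=\frac{M_*^2+M^2}{2M^2},\quad \beta=\sqrt{M_*^2-M^2},\quad a_0=-\frac{\beta^2R}{2M^2}.$$ **Linearized problem** (dimensionless). For 1-shocks the perturbation ahead of the shock may be taken to be zero. The unknowns are the perturbation behind the shock, $U=(p,v_1,v_2,F_{11},F_{21},F_{12},F_{22})$, and the front perturbation $\varphi(t,x_2)$. With $\mathcal{F}_1=(\mathcal{F}_{11},\mathcal{F}_{21})$, $\mathcal{F}_2=(\mathcal{F}_{12},\mathcal{F}_{22})$ and $L=\partial_t+\partial_1$, for $x_1>0$: $$Lp+\mathrm{div}\,v=0,\quad M^2Lv+\nabla p-(\mathcal{F}_1\cdot\nabla)F_1-(\mathcal{F}_2\cdot\nabla)F_2=0,\quad LF_j-(\mathcal{F}_j\cdot\nabla)v=0\ (j=1,2),$$ and on $x_1=0$: $$v_1+d_0p-\frac{\ell_0}{M^2R}v_2=0,\quad a_0p+(1-R)\Big(\partial_t-\frac{\ell_0}{M^2}\partial_2\Big)\varphi=0,\quad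 v_2+(1-R)\partial_2\varphi=0,$$ $$F_{11}+\mathcal{F}_{11}p-\frac{\mathcal{F}_{21}}{R}v_2=0,\quad F_{12}+\mathcal{F}_{12}p-\frac{\mathcal{F}_{22}}{R}v_2=0,\quad F_{21}-\mathcal{F}_{11}v_2=0,\quad F_{22}-\mathcal{F}_{12}v_2=0.$$ Eliminating $\varphi$ by cross differentiation replaces the two conditions containing $\varphi$ by $\big(\partial_t-\frac{\ell_0}{M^2}\partial_2\big)v_2=a_0\partial_2p$, which leaves six boundary conditions. Write the interior system as $\mathcal{A}_0\partial_tU+\mathcal{A}_1\partial_1U+\mathcal{A}_2\partial_2U=0$ with symmetric $7\times7$ matrices $\mathcal{A}_0=\mathrm{diag}(1,M^2I_2,I_4)$, $$\mathcal{A}_1=\begin{pmatrix}1&e_1&\underline0&\underline0\\ e_1^\top&M^2I_2&-\mathcal{F}_{11}I_2&-\mathcal{F}_{12}I_2\\ \underline0^\top&-\mathcal{F}_{11}I_2&I_2&O_2\\ \underline0^\top&-\mathcal{F}_{12}I_2&O_2&I_2\end{pmatrix},\quad \mathcal{A}_2=\begin{pmatrix}0&e_2&\underline0&\underline0\\ e_2^\top&O_2&-\mathcal{F}_{21}I_2&-\mathcal{F}_{22}I_2\\ \underline0^\top&-\mathcal{F}_{21}I_2&O_2&O_2\\ \underline0^\top&-\mathcal{F}_{22}I_2&O_2&O_2\end{pmatrix},$$ where $e_1=(1,0)$, $e_2=(0,1)$, $\underline0=(0,0)$, and $I_m$, $O_m$ are the unit and zero matrices of order $m$. Write the six boundary conditions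 as $\mathfrak{B}_0\partial_tU+\mathfrak{B}_2\partial_2U+\mathfrak{B}_3U=0$ with $6\times7$ matrices $\mathfrak{B}_\alpha$. **Lopatinski determinant.** Let $s=\eta+i\xi$ and $(\xi,\omega)\in\mathbb{R}^2$. Under the Lax conditions $\mathcal{A}_1$ has exactly one negative eigenvalue and, for $\eta>0$, the equation $\det(s\mathcal{A}_0+\lambda\mathcal{A}_1+i\omega\mathcal{A}_2)=0$ has a unique root $\lambda=\lambda^+(\eta,\xi,\omega)$ with $\mathrm{Re}\,\lambda>0$, and this root is simple. For $\eta=0$ set $\lambda^+(0,\xi,\omega)=\lim_{\eta\to+0}\lambda^+(\eta,\xi,\omega)$. Let $\widetilde U_0=\widetilde U_0(s,\omega)\in\mathbb{C}^7$ be the nonzero vector (unique up to a scalar factor) with $(s\mathfrak{B}_0+i\omega\mathfrak{B}_2+\mathfrak{B}_3)\widetilde U_0=0$. The $7\times7$ matrix $\mathfrak{L}=\mathfrak{L}(\eta,\xi,\omega,\lambda^+)$ consists of six linearly independent rows of $s\mathcal{A}_0+\lambda^+\mathcal{A}_1+i\omega\mathcal{A}_2$ together with the row $(\mathcal{A}_1\widetilde U_0)^\top$ (transpose without complex conjugation). Thus $\det\mathfrak{L}=0$ if and only if there is $X\neq0$ in $\mathbb{C}^7$ with $(s\mathcal{A}_0+\lambda^+\mathcal{A}_1+i\omega\mathcal{A}_2)X=0$ and $(\mathcal{A}_1\widetilde U_0)^\top X=0$. **Definitions.** - The *Lopatinski condition* holds if $\det\mathfrak{L}\neq0$ for all $\eta>0$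 and $(\xi,\omega)\in\mathbb{R}^2$. - The *uniform Lopatinski condition* holds if $\det\mathfrak{L}\neq0$ for all $\eta\ge0$ and $(\xi,\omega)\in\mathbb{R}^2$ with $\eta^2+\xi^2+\omega^2\neq0$. - The shock is *uniformly stable* if the linearized problem satisfies the uniform Lopatinski condition. - The shock is *weakly stable* if the linearized problem satisfies the Lopatinski condition but violates the uniform Lopatinski condition. *)

theory Defs
  imports "HOL-Analysis.Analysis"
begin

text \<open>
  The equation of state is the density as a function of the pressure, on an open interval \<open>P\<close> of
  admissible pressures (e.g. the positive reals for a polytropic gas, or all of \<open>UNIV\<close>).
\<close>

definition equation_of_state :: "real set \<Rightarrow> (real \<Rightarrow> real) \<Rightarrow> bool" where
  "equation_of_state P \<rho> \<longleftrightarrow>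
     open P \<and> is_interval P \<and>
     (\<forall>n. (deriv ^^ n) \<rho> differentiable_on P) \<and>
     (\<forall>p\<in>P. \<rho> p > 0 \<and> deriv \<rho> p > 0)"

definition sound_speed :: "(real \<Rightarrow> real) \<Rightarrow> real \<Rightarrow> real" where
  "sound_speed \<rho> p = 1 / sqrt (deriv \<rho> p)"

text \<open>In the deformation gradient, \<open>F $ i $ j\<close> is the entry in row \<open>i\<close> and column \<open>j\<close>.\<close>

record fluid_state =
  press :: real
  vel :: "real^2"
  defgrad :: "real^2^2"

text \<open>\<open>Um\<close> is the state in \<open>x\<^sub>1 < 0\<close> (upstream), \<open>Up\<close> the state in \<open>x\<^sub>1 > 0\<close> (downstream).\<close>

definition rectilinear_shock ::
    "real set \<Rightarrow> (real \<Rightarrow> real) \<Rightarrow> fluid_state \<Rightarrow> fluid_state \<Rightarrow> bool" where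
  "rectilinear_shock P \<rho> Um Up \<longleftrightarrow>
     equation_of_state P \<rho> \<and> press Um \<in> P \<and> press Up \<in> P \<and>
     \<rho> (press Up) \<noteq> \<rho> (press Um) \<and>
     vel Um $ 1 > 0 \<and> vel Up $ 1 > 0 \<and> vel Um $ 2 = 0 \<and> vel Up $ 2 = 0 \<and>
     \<rho> (press Up) / \<rho> (press Um) = vel Um $ 1 / vel Up $ 1 \<and>
     \<rho> (press Up) / \<rho> (press Um)
         * ((vel Up $ 1)\<^sup>2 - (defgrad Up $ 1 $ 1)\<^sup>2 - (defgrad Up $ 1 $ 2)\<^sup>2)
         * (\<rho> (press Up) - \<rho> (press Um))
       = press Up - press Um \<and>
     (\<forall>j. defgrad Up $ 2 $ j = defgrad Um $ 2 $ j) \<and>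
     (\<forall>j. \<rho> (press Up) * defgrad Up $ 1 $ j = \<rho> (press Um) * defgrad Um $ 1 $ j)"

text \<open>Applied to \<open>Up\<close> this is \<open>M\<close>; applied to \<open>Um\<close> it is \<open>M\<^sub>-\<close>.\<close>

definition mach :: "(real \<Rightarrow> real) \<Rightarrow> fluid_state \<Rightarrow> real" where
  "mach \<rho> U = vel U $ 1 / sound_speed \<rho> (press U)"

definition density_ratio :: "(real \<Rightarrow> real) \<Rightarrow> fluid_state \<Rightarrow> fluid_state \<Rightarrow> real" where
  "density_ratio \<rho> Um Up = \<rho> (press Up) / \<rho> (press Um)"

definition scaled_defgrad :: "(real \<Rightarrow> real) \<Rightarrow> fluid_state \<Rightarrow> real^2^2" where
  "scaled_defgrad \<rho> Up = (\<chi> i j. defgrad Up $ i $ j / sound_speed \<rho> (press Up))"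

definition M_one :: "real^2^2 \<Rightarrow> real" where
  "M_one \<F> = sqrt ((\<F>$1$1)\<^sup>2 + (\<F>$1$2)\<^sup>2)"

definition M_star :: "real^2^2 \<Rightarrow> real" where
  "M_star \<F> = sqrt (1 + (\<F>$1$1)\<^sup>2 + (\<F>$1$2)\<^sup>2)"

definition ell0 :: "real^2^2 \<Rightarrow> real" where
  "ell0 \<F> = \<F>$1$1 * \<F>$2$1 + \<F>$1$2 * \<F>$2$2"

definition d0 :: "real \<Rightarrow> real^2^2 \<Rightarrow> real" where
  "d0 M \<F> = ((M_star \<F>)\<^sup>2 + M\<^sup>2) / (2 * M\<^sup>2)"

definition beta :: "real \<Rightarrow> real^2^2 \<Rightarrow> real" where
  "beta M \<F> = sqrt ((M_star \<F>)\<^sup>2 - M\<^sup>2)"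

definition a0 :: "real \<Rightarrow> real \<Rightarrow> real^2^2 \<Rightarrow> real" where
  "a0 M R \<F> = - ((beta M \<F>)\<^sup>2 * R / (2 * M\<^sup>2))"

text \<open>
  The components of the unknown are ordered as \<open>U = (p, v\<^sub>1, v\<^sub>2, F\<^sub>1\<^sub>1, F\<^sub>2\<^sub>1, F\<^sub>1\<^sub>2, F\<^sub>2\<^sub>2)\<close>.
  The interior equations are \<open>A0 \<partial>\<^sub>tU + A1 \<partial>\<^sub>1U + A2 \<partial>\<^sub>2U = 0\<close> for \<open>x\<^sub>1 > 0\<close>.
\<close>

definition A0 :: "real \<Rightarrow> real^7^7" where
  "A0 M = vector [
     vector [1, 0,   0,   0, 0, 0, 0],
     vector [0, M\<^sup>2, 0,   0, 0, 0, 0],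
     vector [0, 0,   M\<^sup>2, 0, 0, 0, 0],
     vector [0, 0,   0,   1, 0, 0, 0],
     vector [0, 0,   0,   0, 1, 0, 0],
     vector [0, 0,   0,   0, 0, 1, 0],
     vector [0, 0,   0,   0, 0, 0, 1]]"

definition A1 :: "real \<Rightarrow> real^2^2 \<Rightarrow> real^7^7" where
  "A1 M \<F> = vector [
     vector [1, 1,       0,       0,       0,       0,       0],
     vector [1, M\<^sup>2,     0,       -\<F>$1$1, 0,       -\<F>$1$2, 0],
     vector [0, 0,       M\<^sup>2,     0,       -\<F>$1$1, 0,       -\<F>$1$2],
     vector [0, -\<F>$1$1, 0,       1,       0,       0,       0],
     vector [0, 0,       -\<F>$1$1, 0,       1,       0,       0],
     vector [0, -\<F>$1$2, 0,       0,       0,       1,       0],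
     vector [0, 0,       -\<F>$1$2, 0,       0,       0,       1]]"

definition A2 :: "real^2^2 \<Rightarrow> real^7^7" where
  "A2 \<F> = vector [
     vector [0, 0,       1,       0,       0,       0,       0],
     vector [0, 0,       0,       -\<F>$2$1, 0,       -\<F>$2$2, 0],
     vector [1, 0,       0,       0,       -\<F>$2$1, 0,       -\<F>$2$2],
     vector [0, -\<F>$2$1, 0,       0,       0,       0,       0],
     vector [0, 0,       -\<F>$2$1, 0,       0,       0,       0],
     vector [0, -\<F>$2$2, 0,       0,       0,       0,       0],
     vector [0, 0,       -\<F>$2$2, 0,       0,       0,       0]]"

text \<open>
  The six boundary conditions on \<open>x\<^sub>1 = 0\<close>, written \<open>B0 \<partial>\<^sub>tU + B2 \<partial>\<^sub>2U + B3 U = 0\<close>.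
  Row 2 is \<open>(\<partial>\<^sub>t - (\<ell>\<^sub>0/M\<^sup>2) \<partial>\<^sub>2) v\<^sub>2 = a\<^sub>0 \<partial>\<^sub>2p\<close>, which results from eliminating the front perturbation
  \<open>\<phi>\<close> from \<open>a\<^sub>0 p + (1 - R) (\<partial>\<^sub>t - (\<ell>\<^sub>0/M\<^sup>2) \<partial>\<^sub>2) \<phi> = 0\<close> and \<open>v\<^sub>2 + (1 - R) \<partial>\<^sub>2\<phi> = 0\<close>.
  The other rows, in order, are the conditions on \<open>v\<^sub>1\<close>, \<open>F\<^sub>1\<^sub>1\<close>, \<open>F\<^sub>1\<^sub>2\<close>, \<open>F\<^sub>2\<^sub>1\<close> and \<open>F\<^sub>2\<^sub>2\<close>.
\<close>

definition B0 :: "real^7^6" where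
  "B0 = vector [
     vector [0, 0, 0, 0, 0, 0, 0],
     vector [0, 0, 1, 0, 0, 0, 0],
     vector [0, 0, 0, 0, 0, 0, 0],
     vector [0, 0, 0, 0, 0, 0, 0],
     vector [0, 0, 0, 0, 0, 0, 0],
     vector [0, 0, 0, 0, 0, 0, 0]]"

definition B2 :: "real \<Rightarrow> real \<Rightarrow> real^2^2 \<Rightarrow> real^7^6" where
  "B2 M R \<F> = vector [
     vector [0,           0, 0,              0, 0, 0, 0],
     vector [- a0 M R \<F>, 0, - ell0 \<F> / M\<^sup>2, 0, 0, 0, 0],
     vector [0,           0, 0,              0, 0, 0, 0],
     vector [0,           0, 0,              0, 0, 0, 0],
     vector [0,           0, 0,              0, 0, 0, 0],
     vector [0,           0, 0,              0, 0, 0, 0]]"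

definition B3 :: "real \<Rightarrow> real \<Rightarrow> real^2^2 \<Rightarrow> real^7^6" where
  "B3 M R \<F> = vector [
     vector [d0 M \<F>, 1, - ell0 \<F> / (M\<^sup>2 * R), 0, 0, 0, 0],
     vector [0,      0, 0,                    0, 0, 0, 0],
     vector [\<F>$1$1, 0, - \<F>$2$1 / R,         1, 0, 0, 0],
     vector [\<F>$1$2, 0, - \<F>$2$2 / R,         0, 0, 1, 0],
     vector [0,      0, - \<F>$1$1,             0, 1, 0, 0],
     vector [0,      0, - \<F>$1$2,             0, 0, 0, 1]]"

definition interior_symbol ::
    "real \<Rightarrow> real^2^2 \<Rightarrow> complex \<Rightarrow> complex \<Rightarrow> real \<Rightarrow> complex^7^7" where
  "interior_symbol M \<F> s l \<omega> =
     (\<chi> i j. s * complex_of_real (A0 M $ i $ j) + l * complex_of_real (A1 M \<F> $ i $ j)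
            + \<i> * complex_of_real \<omega> * complex_of_real (A2 \<F> $ i $ j))"

definition boundary_symbol ::
    "real \<Rightarrow> real \<Rightarrow> real^2^2 \<Rightarrow> complex \<Rightarrow> real \<Rightarrow> complex^7^6" where
  "boundary_symbol M R \<F> s \<omega> =
     (\<chi> i j. s * complex_of_real (B0 $ i $ j)
            + \<i> * complex_of_real \<omega> * complex_of_real (B2 M R \<F> $ i $ j)
            + complex_of_real (B3 M R \<F> $ i $ j))"

text \<open>
  The root with positive real part for \<open>\<eta> > 0\<close>, extended to \<open>\<eta> = 0\<close> by its one-sided limit.
  Negative \<open>\<eta>\<close> do not occur.
\<close>

definition lambda_interior :: "real \<Rightarrow> real^2^2 \<Rightarrow> real \<Rightarrow> real \<Rightarrow> real \<Rightarrow> complex" where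
  "lambda_interior M \<F> \<eta> \<xi> \<omega> =
     (THE l. det (interior_symbol M \<F> (Complex \<eta> \<xi>) l \<omega>) = 0 \<and> Re l > 0)"

definition lambda_plus :: "real \<Rightarrow> real^2^2 \<Rightarrow> real \<Rightarrow> real \<Rightarrow> real \<Rightarrow> complex" where
  "lambda_plus M \<F> \<eta> \<xi> \<omega> =
     (if \<eta> > 0 then lambda_interior M \<F> \<eta> \<xi> \<omega>
      else Lim (at_right 0) (\<lambda>h. lambda_interior M \<F> h \<xi> \<omega>))"

text \<open>Unique up to a nonzero scalar factor; the factor is irrelevant for the vanishing of the determinant.\<close>

definition boundary_null_vector ::
    "real \<Rightarrow> real \<Rightarrow> real^2^2 \<Rightarrow> complex \<Rightarrow> real \<Rightarrow> complex^7" where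
  "boundary_null_vector M R \<F> s \<omega> = (SOME U. U \<noteq> 0 \<and> boundary_symbol M R \<F> s \<omega> *v U = 0)"

text \<open>
  \<open>L\<close> has six linearly independent rows of \<open>N\<close>, all but the one with index \<open>r\<close>, and the row \<open>w\<close>,
  which is put in the place of the omitted row.  The position of \<open>w\<close> affects only the
  sign of \<open>det L\<close>.  Injectivity is needed because linear independence is a
  property of the set of rows rather than of the family.
\<close>

definition bordered_by :: "'a::field^7^7 \<Rightarrow> 'a^7 \<Rightarrow> 'a^7^7 \<Rightarrow> bool" where
  "bordered_by N w L \<longleftrightarrow>
     (\<exists>r. inj_on (\<lambda>i. row i N) (- {r}) \<and> vec.independent ((\<lambda>i. row i N) ` (- {r})) \<and>
          (\<forall>i. row i L = (if i = r then w else row i N)))"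

text \<open>
  The choice of the six rows affects \<open>det L\<close> only by a nonzero factor.  The row \<open>(A1 U\<^sub>0)\<^sup>T\<close> is taken
  without complex conjugation.
\<close>

definition lopatinski_matrix ::
    "real \<Rightarrow> real \<Rightarrow> real^2^2 \<Rightarrow> real \<Rightarrow> real \<Rightarrow> real \<Rightarrow> complex^7^7" where
  "lopatinski_matrix M R \<F> \<eta> \<xi> \<omega> =
     (SOME L. bordered_by
        (interior_symbol M \<F> (Complex \<eta> \<xi>) (lambda_plus M \<F> \<eta> \<xi> \<omega>) \<omega>)
        (map_matrix complex_of_real (A1 M \<F>) *v boundary_null_vector M R \<F> (Complex \<eta> \<xi>) \<omega>)
        L)"

definition lopatinski_condition :: "real \<Rightarrow> real \<Rightarrow> real^2^2 \<Rightarrow> bool" where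
  "lopatinski_condition M R \<F> \<longleftrightarrow>
     (\<forall>\<eta> \<xi> \<omega>. \<eta> > 0 \<longrightarrow> det (lopatinski_matrix M R \<F> \<eta> \<xi> \<omega>) \<noteq> 0)"

definition uniform_lopatinski_condition :: "real \<Rightarrow> real \<Rightarrow> real^2^2 \<Rightarrow> bool" where
  "uniform_lopatinski_condition M R \<F> \<longleftrightarrow>
     (\<forall>\<eta> \<xi> \<omega>. \<eta> \<ge> 0 \<and> \<eta>\<^sup>2 + \<xi>\<^sup>2 + \<omega>\<^sup>2 \<noteq> 0 \<longrightarrow> det (lopatinski_matrix M R \<F> \<eta> \<xi> \<omega>) \<noteq> 0)"

definition uniformly_stable :: "(real \<Rightarrow> real) \<Rightarrow> fluid_state \<Rightarrow> fluid_state \<Rightarrow> bool" where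
  "uniformly_stable \<rho> Um Up \<longleftrightarrow>
     uniform_lopatinski_condition (mach \<rho> Up) (density_ratio \<rho> Um Up) (scaled_defgrad \<rho> Up)"

definition weakly_stable :: "(real \<Rightarrow> real) \<Rightarrow> fluid_state \<Rightarrow> fluid_state \<Rightarrow> bool" where
  "weakly_stable \<rho> Um Up \<longleftrightarrow>
     lopatinski_condition (mach \<rho> Up) (density_ratio \<rho> Um Up) (scaled_defgrad \<rho> Up) \<and>
     \<not> uniform_lopatinski_condition (mach \<rho> Up) (density_ratio \<rho> Um Up) (scaled_defgrad \<rho> Up)"

end

theory Submission
  imports Defs
begin

text \<open>
  Let \<open>\<sigma> = s + \<lambda>\<close>, \<open>a\<^sub>j = \<lambda>\<F>\<^sub>1\<^sub>j + i\<omega>\<F>\<^sub>2\<^sub>j\<close> and \<open>K = M\<^sup>2\<sigma>\<^sup>2 - a\<^sub>1\<^sup>2 - a\<^sub>2\<^sup>2\<close>. Where \<open>\<sigma>K \<noteq> 0\<close>, the interior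
  symbol is singular exactly on the acoustic branch \<open>K = \<lambda>\<^sup>2 - \<omega>\<^sup>2\<close>, a quadratic equation for \<open>\<lambda>\<close>, and
  its kernel is spanned by an explicit vector \<open>X\<close>. Pairing \<open>X\<close> with \<open>A\<^sub>1U\<^sub>0\<close> and reducing with the
  quadratic equation, the Lopatinski determinant vanishes iff \<open>\<beta>\<^sup>2\<lambda>\<^sup>2 = \<omega>\<^sup>2Q\<close> with
  \<open>Q = 1 - R(M\<^sup>2 - M\<^sub>1\<^sup>2)\<close>. This excludes \<open>Re \<lambda> > 0\<close>, so the Lopatinski condition always holds. On
  \<open>\<eta> = 0\<close> the real values of \<open>\<lambda>\<^sup>+/(i\<omega>)\<close> fill the complement of an open interval; the shock is
  uniformly stable iff both numbers \<open>\<plusminus>\<surd>(-Q)/\<beta>\<close> are in that interval or \<open>Q > 0\<close>, which is the stated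
  inequality.
\<close>

subsection \<open>Bordered symmetric matrices\<close>

lemma exhaust_6:
  fixes x :: 6
  shows "x = 1 \<or> x = 2 \<or> x = 3 \<or> x = 4 \<or> x = 5 \<or> x = 6"
proof (induct x)
  case (of_int z)
  then have "z = 0 \<or> z = 1 \<or> z = 2 \<or> z = 3 \<or> z = 4 \<or> z = 5" by (simp, presburger)
  then show ?case by auto
qed

lemma exhaust_7:
  fixes x :: 7
  shows "x = 1 \<or> x = 2 \<or> x = 3 \<or> x = 4 \<or> x = 5 \<or> x = 6 \<or> x = 7"
proof (induct x)
  case (of_int z)
  then have "z = 0 \<or> z = 1 \<or> z = 2 \<or> z = 3 \<or> z = 4 \<or> z = 5 \<or> z = 6" by (simp, presburger)
  then show ?case by auto
qed

lemma forall_6: "(\<forall>i::6. P i) \<longleftrightarrow> P 1 \<and> P 2 \<and> P 3 \<and> P 4 \<and> P 5 \<and> P 6"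
  by (metis exhaust_6)

lemma forall_7: "(\<forall>i::7. P i) \<longleftrightarrow> P 1 \<and> P 2 \<and> P 3 \<and> P 4 \<and> P 5 \<and> P 6 \<and> P 7"
  by (metis exhaust_7)

lemma UNIV_7: "UNIV = {1, 2, 3, 4, 5, 6, 7::7}"
  using exhaust_7 by auto

lemma sum_7: "sum f (UNIV::7 set) = f 1 + f 2 + f 3 + f 4 + f 5 + f 6 + f 7"
  unfolding UNIV_7 by (simp add: ac_simps)

lemma vector_6:
  "(vector [a, b, c, d, e, f] :: 'a::zero^6) $ 1 = a"
  "(vector [a, b, c, d, e, f] :: 'a::zero^6) $ 2 = b"
  "(vector [a, b, c, d, e, f] :: 'a::zero^6) $ 3 = c"
  "(vector [a, b, c, d, e, f] :: 'a::zero^6) $ 4 = d"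
  "(vector [a, b, c, d, e, f] :: 'a::zero^6) $ 5 = e"
  "(vector [a, b, c, d, e, f] :: 'a::zero^6) $ 6 = f"
  by (simp_all add: vector_def)

lemma vector_7:
  "(vector [a, b, c, d, e, f, g] :: 'a::zero^7) $ 1 = a"
  "(vector [a, b, c, d, e, f, g] :: 'a::zero^7) $ 2 = b"
  "(vector [a, b, c, d, e, f, g] :: 'a::zero^7) $ 3 = c"
  "(vector [a, b, c, d, e, f, g] :: 'a::zero^7) $ 4 = d"
  "(vector [a, b, c, d, e, f, g] :: 'a::zero^7) $ 5 = e"
  "(vector [a, b, c, d, e, f, g] :: 'a::zero^7) $ 6 = f"
  "(vector [a, b, c, d, e, f, g] :: 'a::zero^7) $ 7 = g"
  by (simp_all add: vector_def)

section \<open>Row relations, kernels and bordered determinants\<close>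

lemma det_eq_0_iff_kernel:
  fixes A :: "'a::field^'n^'n"
  shows "det A = 0 \<longleftrightarrow> (\<exists>x. x \<noteq> 0 \<and> A *v x = 0)"
  by (metis invertible_det_nz invertible_left_inverse matrix_left_invertible_ker)

text \<open>Turns the set-based independence in \<open>bordered_by\<close> into a statement about
  coefficient families. Injectivity is covered by the relation with coefficients 1 and -1 at two
  equal members.\<close>

lemma independent_family_iff:
  fixes f :: "'i \<Rightarrow> 'a::field^'n"
  assumes "finite A"
  shows "inj_on f A \<and> vec.independent (f ` A) \<longleftrightarrow>
    (\<forall>c. (\<Sum>i\<in>A. c i *s f i) = 0 \<longrightarrow> (\<forall>i\<in>A. c i = 0))" (is "?L \<longleftrightarrow> ?R")
proof
  assume L: ?L
  show ?R
  proof (intro allI impI ballI)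
    fix c i
    assume c: "(\<Sum>i\<in>A. c i *s f i) = 0" and i: "i \<in> A"
    let ?u = "\<lambda>v. c (inv_into A f v)"
    have "(\<Sum>v\<in>f ` A. ?u v *s v) = (\<Sum>i\<in>A. c i *s f i)"
      using L by (subst sum.reindex) (auto intro!: sum.cong)
    then have "(\<Sum>v\<in>f ` A. ?u v *s v) = 0" using c by simp
    then have "?u (f i) = 0"
      using L i assms by (intro vec.independentD[of "f ` A" "f ` A" ?u]) auto
    then show "c i = 0"
      using L i by simp
  qed
next
  assume R: ?R
  have inj: "inj_on f A"
  proof (rule inj_onI, rule ccontr)
    fix i j assume ij: "i \<in> A" "j \<in> A" "f i = f j" "i \<noteq> j"
    let ?c = "\<lambda>k. if k = i then 1 else if k = j then -1 else 0"
    have "(\<Sum>k\<in>A. ?c k *s f k) = (\<Sum>k\<in>{i, j}. ?c k *s f k)"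
      using assms ij by (intro sum.mono_neutral_right) auto
    also have "\<dots> = 0"
      using ij by simp
    finally show False
      using R[rule_format, of ?c i] ij by simp
  qed
  moreover have "vec.independent (f ` A)"
  proof
    assume "vec.dependent (f ` A)"
    then obtain u where u: "\<exists>v\<in>f ` A. u v \<noteq> 0" "(\<Sum>v\<in>f ` A. u v *s v) = 0"
      using assms by (auto simp: vec.dependent_finite)
    then have "(\<Sum>i\<in>A. u (f i) *s f i) = 0"
      using inj by (simp add: sum.reindex)
    then show False
      using u(1) R[rule_format, of "\<lambda>i. u (f i)"] by blast
  qed
  ultimately show ?L ..
qed

text \<open>Rows of a symmetric matrix are also its columns, so relations among rows are the same as
  kernel vectors.\<close>

lemma row_combination_symmetric:
  fixes N :: "'a::comm_semiring_1^'n^'n"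
  assumes "transpose N = N"
  shows "(\<Sum>i\<in>UNIV. c i *s row i N) = N *v (\<chi> i. c i)"
proof -
  have "(\<Sum>i\<in>UNIV. c i *s row i N) = transpose N *v (\<chi> i. c i)"
    by (simp add: vec_eq_iff matrix_vector_mult_def row_def transpose_def mult.commute)
  then show ?thesis
    by (simp add: assms)
qed

lemma row_combination_symmetric_minus:
  fixes N :: "'a::comm_ring_1^'n^'n"
  assumes "transpose N = N" and "c r = 0"
  shows "(\<Sum>i\<in>- {r}. c i *s row i N) = N *v (\<chi> i. c i)"
proof -
  have "(\<Sum>i\<in>- {r}. c i *s row i N) = (\<Sum>i\<in>UNIV. c i *s row i N)"
    using assms(2) by (intro sum.mono_neutral_left) auto
  then show ?thesis
    by (simp add: row_combination_symmetric assms(1))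
qed

text \<open>Omit a row \<open>r\<close> with \<open>X $ r\<close> nonzero. A relation among the
  other rows is a kernel vector with entry 0 at \<open>r\<close>, hence the zero multiple of
  \<open>X\<close>. Existence matters because \<open>lopatinski_matrix\<close> is chosen by
  \<open>SOME\<close>.\<close>

lemma bordered_by_exists:
  fixes N :: "'a::field^7^7"
  assumes sym: "transpose N = N" and "X \<noteq> 0"
    and ker: "\<And>Y. N *v Y = 0 \<Longrightarrow> \<exists>c. Y = c *s X"
  shows "\<exists>L. bordered_by N w L"
proof -
  obtain r where r: "X $ r \<noteq> 0"
    using \<open>X \<noteq> 0\<close> by (auto simp: vec_eq_iff)
  have "c i = 0" if "i \<in> - {r}" and c: "(\<Sum>i\<in>- {r}. c i *s row i N) = 0" for c i
  proof -
    let ?c = "\<lambda>i. if i = r then 0 else c i"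
    have "N *v (\<chi> i. ?c i) = (\<Sum>i\<in>- {r}. ?c i *s row i N)"
      using sym by (subst row_combination_symmetric_minus) auto
    also have "\<dots> = 0"
      using c by (auto intro!: sum.neutral simp flip: c intro: sum.cong)
    finally obtain b where b: "(\<chi> i. ?c i) = b *s X"
      using ker by blast
    then have "(\<chi> i. ?c i) $ r = b * X $ r" by simp
    then have "b = 0" using r by simp
    then have "(\<chi> i. ?c i) $ i = 0" using b by simp
    then show ?thesis using that by simp
  qed
  then have "inj_on (\<lambda>i. row i N) (- {r}) \<and> vec.independent ((\<lambda>i. row i N) ` (- {r}))"
    by (subst independent_family_iff) auto
  then have "bordered_by N w (\<chi> i. if i = r then w else row i N)"
    unfolding bordered_by_def by (intro exI[of _ r]) (auto simp: row_def vec_eq_iff)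
  then show ?thesis ..
qed

text \<open>A kernel vector of \<open>L\<close> turns out to lie in the kernel of \<open>N\<close>,
  so it is a multiple of \<open>X\<close>; the bordering row then only tests whether
  \<open>w\<close> annihilates \<open>X\<close>.\<close>

lemma det_bordered_by_eq_0_iff:
  fixes N :: "'a::field^7^7"
  assumes sym: "transpose N = N" and "X \<noteq> 0" and X: "N *v X = 0"
    and ker: "\<And>Y. N *v Y = 0 \<Longrightarrow> \<exists>c. Y = c *s X"
    and "bordered_by N w L"
  shows "det L = 0 \<longleftrightarrow> (\<Sum>i\<in>UNIV. w $ i * X $ i) = 0"
proof -
  obtain r where ind: "inj_on (\<lambda>i. row i N) (- {r}) \<and> vec.independent ((\<lambda>i. row i N) ` (- {r}))"
    and L: "\<And>i. row i L = (if i = r then w else row i N)"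
    using assms(5) unfolding bordered_by_def by blast
  have mult: "(A *v Y) $ i = (\<Sum>j\<in>UNIV. row i A $ j * Y $ j)" for A :: "'a^7^7" and Y i
    by (simp add: matrix_vector_mult_def row_def)
  have LY: "(L *v Y) $ i = (if i = r then (\<Sum>j\<in>UNIV. w $ j * Y $ j) else (N *v Y) $ i)" for Y i
    by (simp add: mult L)
  \<comment> \<open>Otherwise the entries of \<open>X\<close> would be a nontrivial relation among
    the kept rows.\<close>
  have Xr: "X $ r \<noteq> 0"
  proof
    assume "X $ r = 0"
    then have "(\<Sum>i\<in>- {r}. X $ i *s row i N) = 0"
      using X by (subst row_combination_symmetric_minus[OF sym]) simp_all
    then have "\<forall>i\<in>- {r}. X $ i = 0"
      using ind independent_family_iff[of "- {r}" "\<lambda>i. row i N"] by auto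
    then show False
      using \<open>X $ r = 0\<close> \<open>X \<noteq> 0\<close> by (auto simp: vec_eq_iff)
  qed
  show ?thesis
  proof
    assume "det L = 0"
    then obtain Y where Y: "Y \<noteq> 0" "L *v Y = 0"
      by (auto simp: det_eq_0_iff_kernel)
    have NY: "(N *v Y) $ i = 0" if "i \<noteq> r" for i
      using LY[of Y i] Y that by simp
    \<comment> \<open>By symmetry \<open>X\<close> annihilates \<open>N\<close> from the left too,
      hence also \<open>N *v Y\<close>, whose only possibly nonzero entry is the one at
      \<open>r\<close>.\<close>
    have "(\<Sum>i\<in>UNIV. X $ i *s row i N) = 0"
      using X by (simp add: row_combination_symmetric[OF sym])
    then have "(\<Sum>i\<in>UNIV. X $ i * N $ i $ j) = 0" for j
      by (auto simp: vec_eq_iff row_def)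
    then have "0 = (\<Sum>j\<in>UNIV. (\<Sum>i\<in>UNIV. X $ i * N $ i $ j) * Y $ j)"
      by simp
    also have "\<dots> = (\<Sum>i\<in>UNIV. X $ i * (N *v Y) $ i)"
      unfolding matrix_vector_mult_def sum_distrib_right vec_lambda_beta sum_distrib_left
      by (subst sum.swap) (simp add: mult.assoc)
    also have "\<dots> = (\<Sum>i\<in>{r}. X $ i * (N *v Y) $ i)"
      by (intro sum.mono_neutral_right) (auto simp: NY)
    finally have "(N *v Y) $ r = 0" using Xr by simp
    then have "N *v Y = 0"
      using NY by (metis vec_eq_iff zero_index)
    then obtain c where c: "Y = c *s X" using ker by blast
    have "c * (\<Sum>i\<in>UNIV. w $ i * X $ i) = (L *v Y) $ r"
      by (simp add: LY c sum_distrib_left algebra_simps)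
    then show "(\<Sum>i\<in>UNIV. w $ i * X $ i) = 0"
      using Y c by auto
  next
    assume "(\<Sum>i\<in>UNIV. w $ i * X $ i) = 0"
    then have "L *v X = 0"
      using X by (simp add: vec_eq_iff LY)
    then show "det L = 0"
      using \<open>X \<noteq> 0\<close> by (auto simp: det_eq_0_iff_kernel)
  qed
qed

subsection \<open>The kernels of the two symbols\<close>

text \<open>The \<open>K\<close> of the overview: once \<open>F\<close> is eliminated from the
  momentum equations, each velocity component carries the factor \<open>K / (s + l)\<close>.\<close>

definition elastic :: "real \<Rightarrow> real^2^2 \<Rightarrow> complex \<Rightarrow> complex \<Rightarrow> real \<Rightarrow> complex" where
  "elastic M F s l w = of_real (M\<^sup>2) * (s + l)\<^sup>2
     - ((l * of_real (F$1$1) + \<i> * of_real w * of_real (F$2$1))\<^sup>2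
      + (l * of_real (F$1$2) + \<i> * of_real w * of_real (F$2$2))\<^sup>2)"

text \<open>
  Solve the last four equations for \<open>F\<close>, then the second and third for \<open>v\<close> in terms of \<open>p\<close>; the choice
  \<open>p = K\<close> clears all denominators.
\<close>

definition interior_null_vector :: "real \<Rightarrow> real^2^2 \<Rightarrow> complex \<Rightarrow> complex \<Rightarrow> real \<Rightarrow> complex^7" where
  "interior_null_vector M F s l w =
    (let a1 = l * of_real (F$1$1) + \<i> * of_real w * of_real (F$2$1);
         a2 = l * of_real (F$1$2) + \<i> * of_real w * of_real (F$2$2)
     in vector [elastic M F s l w, - l * (s + l), - \<i> * of_real w * (s + l),
          - l * a1, - \<i> * of_real w * a1, - l * a2, - \<i> * of_real w * a2])"

lemma transpose_interior_symbol [simp]: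
  "transpose (interior_symbol M F s l w) = interior_symbol M F s l w"
  by (simp add: vec_eq_iff forall_7 transpose_def interior_symbol_def A0_def A1_def A2_def vector_7)

lemma interior_symbol_kernel_iff:
  fixes F :: "real^2^2" and s l :: complex and w :: real
  defines "a1 \<equiv> l * of_real (F$1$1) + \<i> * of_real w * of_real (F$2$1)"
    and "a2 \<equiv> l * of_real (F$1$2) + \<i> * of_real w * of_real (F$2$2)"
  shows "interior_symbol M F s l w *v Y = 0 \<longleftrightarrow>
      (s + l) * Y$1 + l * Y$2 + \<i> * of_real w * Y$3 = 0 \<and>
      of_real (M\<^sup>2) * (s + l) * Y$2 + l * Y$1 - a1 * Y$4 - a2 * Y$6 = 0 \<and>
      of_real (M\<^sup>2) * (s + l) * Y$3 + \<i> * of_real w * Y$1 - a1 * Y$5 - a2 * Y$7 = 0 \<and>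
      (s + l) * Y$4 = a1 * Y$2 \<and> (s + l) * Y$5 = a1 * Y$3 \<and>
      (s + l) * Y$6 = a2 * Y$2 \<and> (s + l) * Y$7 = a2 * Y$3"
proof -
  have [simp]: "(s + l) * x = a * y \<longleftrightarrow> (s + l) * x - a * y = 0" for x y a
    by simp
  show ?thesis
    unfolding vec_eq_iff forall_7 matrix_vector_mult_def sum_7 interior_symbol_def A0_def A1_def A2_def a1_def a2_def
    by (simp add: vector_7 algebra_simps)
qed

text \<open>Rows two to seven vanish by the construction of the vector; the dispersion relation is
  needed for the first row, which equals \<open>s + l\<close> times its defect.\<close>

lemma interior_symbol_null_vector:
  assumes "elastic M F s l w = l\<^sup>2 - of_real (w\<^sup>2)"
  shows "interior_symbol M F s l w *v interior_null_vector M F s l w = 0"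
proof -
  have "\<i> * \<i> = -1" by simp
  then show ?thesis
    using assms unfolding interior_symbol_kernel_iff interior_null_vector_def Let_def vector_7 elastic_def
    of_real_power
    by (intro conjI; (algebra | (simp add: algebra_simps)))
qed

text \<open>Multiplying the momentum rows by \<open>s + l\<close> and substituting the last four
  rows gives both velocity components, and then \<open>F\<close>, as multiples of the pressure
  \<open>Y$1\<close> with denominator \<open>K\<close>.\<close>

lemma interior_symbol_kernel:
  assumes NY: "interior_symbol M F s l w *v Y = 0" and \<sigma>: "s + l \<noteq> 0" and K: "elastic M F s l w \<noteq> 0"
  shows "Y = (Y$1 / elastic M F s l w) *s interior_null_vector M F s l w"
    and "Y \<noteq> 0 \<Longrightarrow> elastic M F s l w = l\<^sup>2 - of_real (w\<^sup>2)"
proof -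
  define K where "K = elastic M F s l w"
  define \<sigma> where "\<sigma> = s + l"
  define iw :: complex where "iw = \<i> * of_real w"
  define a1 where "a1 = l * of_real (F$1$1) + iw * of_real (F$2$1)"
  define a2 where "a2 = l * of_real (F$1$2) + iw * of_real (F$2$2)"
  note eqs = NY[unfolded interior_symbol_kernel_iff, folded \<sigma>_def iw_def, folded a1_def a2_def]
  have K_eq: "K = of_real (M\<^sup>2) * \<sigma>\<^sup>2 - (a1\<^sup>2 + a2\<^sup>2)"
    by (simp add: K_def elastic_def \<sigma>_def a1_def a2_def iw_def)
  have "\<sigma> \<noteq> 0" "K \<noteq> 0" using \<sigma> K by (simp_all add: \<sigma>_def K_def)
  have v1: "K * Y$2 = - l * \<sigma> * Y$1"
    using eqs unfolding K_eq by algebra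
  have v2: "K * Y$3 = - iw * \<sigma> * Y$1"
    using eqs unfolding K_eq by algebra
  have F: "K * Y$4 = - l * a1 * Y$1" "K * Y$5 = - iw * a1 * Y$1"
    "K * Y$6 = - l * a2 * Y$1" "K * Y$7 = - iw * a2 * Y$1"
    using v1 v2 eqs \<open>\<sigma> \<noteq> 0\<close> by algebra+
  show Y: "Y = (Y$1 / elastic M F s l w) *s interior_null_vector M F s l w"
    using v1 v2 F \<open>K \<noteq> 0\<close>
    unfolding vec_eq_iff forall_7 interior_null_vector_def Let_def mult_minus_left[of \<i>]
      iw_def[symmetric] \<sigma>_def[symmetric] K_def[symmetric] a1_def[symmetric] a2_def[symmetric]
    by (simp add: vector_7 field_simps)
  assume "Y \<noteq> 0"
  then have "Y$1 \<noteq> 0" using Y by auto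
  \<comment> \<open>This is the first row multiplied by \<open>K\<close>, with the velocities
    replaced by means of \<open>v1\<close> and \<open>v2\<close>.\<close>
  moreover have "\<sigma> * Y$1 * (K - l\<^sup>2 - iw\<^sup>2) = 0"
    using eqs v1 v2 by algebra
  ultimately have "K = l\<^sup>2 + iw\<^sup>2" using \<open>\<sigma> \<noteq> 0\<close> by (simp add: diff_eq_eq add.commute)
  then show "elastic M F s l w = l\<^sup>2 - of_real (w\<^sup>2)"
    by (simp add: K_def iw_def power_mult_distrib)
qed

lemma boundary_symbol_kernel_iff:
  "boundary_symbol M R F s w *v U = 0 \<longleftrightarrow>
      of_real (d0 M F) * U$1 + U$2 - of_real (ell0 F / (M\<^sup>2 * R)) * U$3 = 0 \<and>
      (s - \<i> * of_real w * of_real (ell0 F / M\<^sup>2)) * U$3 = \<i> * of_real w * of_real (a0 M R F) * U$1 \<and>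
      of_real (F$1$1) * U$1 - of_real (F$2$1 / R) * U$3 + U$4 = 0 \<and>
      of_real (F$1$2) * U$1 - of_real (F$2$2 / R) * U$3 + U$6 = 0 \<and>
      U$5 = of_real (F$1$1) * U$3 \<and> U$7 = of_real (F$1$2) * U$3"
proof -
  have 1: "x * U$3 = y \<longleftrightarrow> x * U$3 - y = 0" "U$5 = a \<longleftrightarrow> U$5 - a = 0" "U$7 = a \<longleftrightarrow> U$7 - a = 0" for x y a
    by simp_all
  show ?thesis
    unfolding vec_eq_iff forall_6 matrix_vector_mult_def sum_7 boundary_symbol_def B0_def B2_def B3_def 1
    by (simp add: vector_7 vector_6 algebra_simps)
qed

text \<open>Five rows express \<open>v1\<close> and \<open>F\<close> through \<open>p\<close> and
  \<open>v2\<close>; the remaining one fixes the ratio of \<open>p\<close> and \<open>v2\<close>.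
  The factor \<open>c\<close> absorbs the choice made by \<open>SOME\<close>.\<close>

lemma boundary_null_vector:
  assumes "a0 M R F \<noteq> 0" and "s \<noteq> 0 \<or> w \<noteq> 0"
  defines "U \<equiv> boundary_null_vector M R F s w"
  obtains c where "c \<noteq> 0"
    "U$1 = c * (s - \<i> * of_real w * of_real (ell0 F / M\<^sup>2))"
    "U$2 = - of_real (d0 M F) * U$1 + of_real (ell0 F / (M\<^sup>2 * R)) * U$3"
    "U$3 = c * (\<i> * of_real w * of_real (a0 M R F))"
    "U$4 = - of_real (F$1$1) * U$1 + of_real (F$2$1 / R) * U$3"
    "U$5 = of_real (F$1$1) * U$3"
    "U$6 = - of_real (F$1$2) * U$1 + of_real (F$2$2 / R) * U$3"
    "U$7 = of_real (F$1$2) * U$3"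
proof -
  define p where "p = s - \<i> * of_real w * of_real (ell0 F / M\<^sup>2)"
  define v where "v = \<i> * of_real w * of_real (a0 M R F)"
  \<comment> \<open>If \<open>w\<close> is nonzero so is \<open>v\<close>, as \<open>a0\<close> does
    not vanish; if \<open>w = 0\<close> then \<open>p = s\<close>.\<close>
  have pv: "p \<noteq> 0 \<or> v \<noteq> 0"
    using assms by (cases "w = 0") (auto simp: p_def v_def)
  define V :: "complex^7" where "V = vector [p,
      - of_real (d0 M F) * p + of_real (ell0 F / (M\<^sup>2 * R)) * v, v,
      - of_real (F$1$1) * p + of_real (F$2$1 / R) * v, of_real (F$1$1) * v,
      - of_real (F$1$2) * p + of_real (F$2$2 / R) * v, of_real (F$1$2) * v]"
  have "V \<noteq> 0"
    using pv by (auto simp: vec_eq_iff forall_7 V_def vector_7)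
  moreover have "boundary_symbol M R F s w *v V = 0"
    unfolding boundary_symbol_kernel_iff p_def[symmetric] v_def[symmetric]
    by (simp add: V_def vector_7)
  ultimately have "\<exists>U. U \<noteq> 0 \<and> boundary_symbol M R F s w *v U = 0" by blast
  from someI_ex[OF this] have "U \<noteq> 0 \<and> boundary_symbol M R F s w *v U = 0"
    unfolding U_def boundary_null_vector_def .
  then have "U \<noteq> 0" and eqs: "of_real (d0 M F) * U$1 + U$2 - of_real (ell0 F / (M\<^sup>2 * R)) * U$3 = 0"
    "p * U$3 = v * U$1"
    "of_real (F$1$1) * U$1 - of_real (F$2$1 / R) * U$3 + U$4 = 0"
    "of_real (F$1$2) * U$1 - of_real (F$2$2 / R) * U$3 + U$6 = 0"
    "U$5 = of_real (F$1$1) * U$3" "U$7 = of_real (F$1$2) * U$3"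
    by (simp_all add: boundary_symbol_kernel_iff p_def v_def)
  obtain c where c: "U$1 = c * p" "U$3 = c * v"
  proof (cases "p = 0")
    case True
    then show ?thesis using that[of "U$3 / v"] pv eqs(2) by auto
  next
    case False
    then show ?thesis using that[of "U$1 / p"] eqs(2) by (auto simp: field_simps)
  qed
  have "c \<noteq> 0"
  proof
    assume "c = 0"
    then have "U = 0"
      using c eqs by (simp add: vec_eq_iff forall_7)
    then show False using \<open>U \<noteq> 0\<close> by simp
  qed
  moreover have "U$2 = - of_real (d0 M F) * U$1 + of_real (ell0 F / (M\<^sup>2 * R)) * U$3"
    "U$4 = - of_real (F$1$1) * U$1 + of_real (F$2$1 / R) * U$3"
    "U$6 = - of_real (F$1$2) * U$1 + of_real (F$2$2 / R) * U$3"
    using eqs by algebra+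
  ultimately show ?thesis
    using that[of c] c eqs(5,6) unfolding p_def v_def by blast
qed

text \<open>The pairing as an identity in abstract complex variables, with \<open>q\<close> and
  \<open>r\<close> standing for the inverses of \<open>M2\<close> and \<open>R\<close> so that
  \<open>algebra\<close> applies. Only five terms occur on the left: the fifth and seventh entries
  of \<open>A1\<close> times the boundary vector are zero.\<close>

lemma lopatinski_pairing_algebra:
  fixes f11 f12 f21 f22 M2 R q r h d e b2 a s l iw c p v K :: complex
  assumes q: "M2 * q = 1" and r: "R * r = 1"
    and l0: "h = f11 * f21 + f12 * f22" and b2: "b2 = 1 + f11\<^sup>2 + f12\<^sup>2 - M2"
    and d: "d = (1 + f11\<^sup>2 + f12\<^sup>2 + M2) * q / 2" and e: "e = h * q * r"
    and a: "a = - (b2 * R * q / 2)"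
    and p: "p = c * (s - iw * h * q)" and v: "v = c * (iw * a)"
    and K: "K = M2 * (s + l)\<^sup>2 - ((l * f11 + iw * f21)\<^sup>2 + (l * f12 + iw * f22)\<^sup>2)"
    and disp: "K = l\<^sup>2 + iw\<^sup>2"
  defines "a1 \<equiv> l * f11 + iw * f21" and "a2 \<equiv> l * f12 + iw * f22"
  shows "(p + (- d * p + e * v)) * K
    + (p + M2 * (- d * p + e * v) - f11 * (- f11 * p + f21 * r * v) - f12 * (- f12 * p + f22 * r * v)) * (- l * (s + l))
    + (M2 * v - f11 * (f11 * v) - f12 * (f12 * v)) * (- iw * (s + l))
    + (- f11 * (- d * p + e * v) + (- f11 * p + f21 * r * v)) * (- l * a1)
    + (- f12 * (- d * p + e * v) + (- f12 * p + f22 * r * v)) * (- l * a2)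
    = c * (- b2 * q / 2) * (s + l) * (b2 * l\<^sup>2 - iw\<^sup>2 * (R * (M2 - f11\<^sup>2 - f12\<^sup>2) - 1))"
proof -
  define b where "b = f11 * a1 + f12 * a2"
  define cc where "cc = f21 * a1 + f22 * a2"
  define \<sigma> where "\<sigma> = s + l"
  define m where "m = f11\<^sup>2 + f12\<^sup>2"
  define n where "n = f21\<^sup>2 + f22\<^sup>2"
  have d1: "1 - d = - b2 * q / 2"
    using q unfolding d b2 by (simp add: field_simps)
  have d2: "1 + m - M2 * d = b2 / 2"
  proof -
    have "M2 * d = (1 + m + M2) * (M2 * q) / 2" unfolding d m_def by (simp add: algebra_simps)
    then show ?thesis using q unfolding b2 m_def by (simp add: field_simps)
  qed
  \<comment> \<open>\<open>b\<close> and \<open>cc\<close> contract the two rows of the deformation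
    gradient with \<open>a1\<close> and \<open>a2\<close>, so that \<open>l * b + iw * cc\<close> is
    the sum of the squares of \<open>a1\<close> and \<open>a2\<close>.\<close>
  have bK: "K + l * b = M2 * \<sigma>\<^sup>2 - iw * cc"
    unfolding K b_def cc_def a1_def a2_def \<sigma>_def by algebra
  have cc: "cc = l * h + iw * n"
    unfolding cc_def a1_def a2_def l0 n_def by algebra
  have "M2 * e = r * h" using q unfolding e by algebra
  \<comment> \<open>The choice of \<open>e\<close> makes the \<open>v\<close> terms cancel.\<close>
  then have g2: "p + M2 * (- d * p + e * v) - f11 * (- f11 * p + f21 * r * v) - f12 * (- f12 * p + f22 * r * v)
      = b2 / 2 * p"
    using d2 unfolding m_def l0 by algebra
  have "(p + (- d * p + e * v)) * K
    + (p + M2 * (- d * p + e * v) - f11 * (- f11 * p + f21 * r * v) - f12 * (- f12 * p + f22 * r * v)) * (- l * (s + l))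
    + (M2 * v - f11 * (f11 * v) - f12 * (f12 * v)) * (- iw * (s + l))
    + (- f11 * (- d * p + e * v) + (- f11 * p + f21 * r * v)) * (- l * a1)
    + (- f12 * (- d * p + e * v) + (- f12 * p + f22 * r * v)) * (- l * a2)
    = (1 - d) * p * (K + l * b) + e * v * (K + l * b) - l * r * cc * v - b2 / 2 * p * l * \<sigma> - (M2 - m) * iw * \<sigma> * v"
    unfolding g2 unfolding b_def cc_def \<sigma>_def m_def by algebra
  \<comment> \<open>Each of \<open>1 - d\<close>, \<open>e * v\<close>, \<open>r * v\<close>,
    \<open>v\<close> and the term in \<open>b2 / 2\<close> contains the factor
    \<open>- b2 * q / 2\<close>.\<close>
  also have "\<dots> = (- b2 * q / 2) * (p * (K + l * b + M2 * l * \<sigma>) + c * iw * (h * q * (K + l * b) - l * cc - (M2 - m) * R * iw * \<sigma>))"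
  proof -
    have 1: "e * v = (- b2 * q / 2) * c * iw * h * q"
      using r unfolding e v a by algebra
    have 2: "r * v = (- b2 * q / 2) * c * iw"
      using r unfolding v a by algebra
    have 3: "v = (- b2 * q / 2) * c * iw * R"
      unfolding v a by simp
    have 4: "b2 / 2 * p * l * \<sigma> = - (- b2 * q / 2) * p * M2 * l * \<sigma>"
      using q by algebra
    have "(1 - d) * p * (K + l * b) + e * v * (K + l * b) - l * r * cc * v - b2 / 2 * p * l * \<sigma> - (M2 - m) * iw * \<sigma> * v
      = (1 - d) * p * (K + l * b) + e * v * (K + l * b) - l * cc * (r * v) - b2 / 2 * p * l * \<sigma> - (M2 - m) * iw * \<sigma> * v"
      by simp
    also have "\<dots> = (- b2 * q / 2) * (p * (K + l * b + M2 * l * \<sigma>) + c * iw * (h * q * (K + l * b) - l * cc - (M2 - m) * R * iw * \<sigma>))"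
      unfolding d1 1 2 4 using 3 by algebra
    finally show ?thesis .
  qed
  also have "p * (K + l * b + M2 * l * \<sigma>) + c * iw * (h * q * (K + l * b) - l * cc - (M2 - m) * R * iw * \<sigma>)
     = c * (s * (K + l * b) + (s * M2 - iw * h) * l * \<sigma> - iw * l * cc - (M2 - m) * R * iw\<^sup>2 * \<sigma>)"
    unfolding p using q by algebra
  \<comment> \<open>The two terms in \<open>cc\<close> combine to
    \<open>- iw * \<sigma> * cc\<close>, after which \<sigma> is a common factor.\<close>
  also have "\<dots> = c * \<sigma> * (M2 * s\<^sup>2 + 2 * M2 * s * l - 2 * iw * h * l - iw\<^sup>2 * (n + R * (M2 - m)))"
    unfolding bK cc \<sigma>_def by algebra
  \<comment> \<open>The dispersion relation removes \<open>s\<close> completely and leaves a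
    condition on \<open>l\<close> and \<open>iw\<close> alone.\<close>
  also have "M2 * s\<^sup>2 + 2 * M2 * s * l - 2 * iw * h * l - iw\<^sup>2 * (n + R * (M2 - m))
     = b2 * l\<^sup>2 - iw\<^sup>2 * (R * (M2 - m) - 1) + (K - (l\<^sup>2 + iw\<^sup>2))"
    unfolding K b2 n_def m_def l0 by (simp add: algebra_simps power2_eq_square)
  also have "\<dots> = b2 * l\<^sup>2 - iw\<^sup>2 * (R * (M2 - m) - 1)"
    using disp by simp
  also have "- b2 * q / 2 * (c * \<sigma> * (b2 * l\<^sup>2 - iw\<^sup>2 * (R * (M2 - m) - 1)))
     = c * (- b2 * q / 2) * (s + l) * (b2 * l\<^sup>2 - iw\<^sup>2 * (R * (M2 - f11\<^sup>2 - f12\<^sup>2) - 1))"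
    by (simp add: \<sigma>_def m_def diff_diff_eq)
  finally show ?thesis .
qed

text \<open>The factors in front of the last one, among them \<open>c\<close>, the square of
  \<open>beta\<close> and \<open>s + l\<close>, are nonzero, so only the last factor
  decides.\<close>

lemma lopatinski_pairing:
  assumes M: "M \<noteq> 0" and R: "R \<noteq> 0" and b: "(beta M F)\<^sup>2 = (M_star F)\<^sup>2 - M\<^sup>2" "beta M F \<noteq> 0"
    and sw: "s \<noteq> 0 \<or> w \<noteq> 0" and K: "elastic M F s l w = l\<^sup>2 - of_real (w\<^sup>2)"
    and \<sigma>: "s + l \<noteq> 0"
  shows "(\<Sum>i\<in>UNIV. (map_matrix complex_of_real (A1 M F) *v boundary_null_vector M R F s w) $ i
      * interior_null_vector M F s l w $ i) = 0 \<longleftrightarrow>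
    of_real ((beta M F)\<^sup>2) * l\<^sup>2 = of_real (w\<^sup>2 * (1 - R * (M\<^sup>2 - (M_one F)\<^sup>2)))"
proof -
  define U where "U = boundary_null_vector M R F s w"
  have "a0 M R F \<noteq> 0" using M R b(2) by (simp add: a0_def)
  then obtain c where "c \<noteq> 0" and c:
    "U$1 = c * (s - \<i> * of_real w * of_real (ell0 F / M\<^sup>2))"
    "U$2 = - of_real (d0 M F) * U$1 + of_real (ell0 F / (M\<^sup>2 * R)) * U$3"
    "U$3 = c * (\<i> * of_real w * of_real (a0 M R F))"
    "U$4 = - of_real (F$1$1) * U$1 + of_real (F$2$1 / R) * U$3"
    "U$5 = of_real (F$1$1) * U$3"
    "U$6 = - of_real (F$1$2) * U$1 + of_real (F$2$2 / R) * U$3"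
    "U$7 = of_real (F$1$2) * U$3"
    using boundary_null_vector[of M R F s w] sw unfolding U_def by metis
  have star: "(M_star F)\<^sup>2 = 1 + (F$1$1)\<^sup>2 + (F$1$2)\<^sup>2" and one: "(M_one F)\<^sup>2 = (F$1$1)\<^sup>2 + (F$1$2)\<^sup>2"
    by (simp_all add: M_star_def M_one_def add_nonneg_nonneg)
  define q where "q = complex_of_real (1 / M\<^sup>2)"
  define r where "r = complex_of_real (1 / R)"
  let ?f = "\<lambda>i j. complex_of_real (F$i$j)"
  let ?b = "complex_of_real ((beta M F)\<^sup>2)"
  define iw where "iw = \<i> * complex_of_real w"
  have "(\<Sum>i\<in>UNIV. (map_matrix complex_of_real (A1 M F) *v U) $ i * interior_null_vector M F s l w $ i)
    = (U$1 + U$2) * elastic M F s l w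
    + (U$1 + of_real (M\<^sup>2) * U$2 - ?f 1 1 * U$4 - ?f 1 2 * U$6) * (- l * (s + l))
    + (of_real (M\<^sup>2) * U$3 - ?f 1 1 * U$5 - ?f 1 2 * U$7) * (- iw * (s + l))
    + (- ?f 1 1 * U$2 + U$4) * (- l * (l * ?f 1 1 + iw * ?f 2 1))
    + (- ?f 1 1 * U$3 + U$5) * (- iw * (l * ?f 1 1 + iw * ?f 2 1))
    + (- ?f 1 2 * U$2 + U$6) * (- l * (l * ?f 1 2 + iw * ?f 2 2))
    + (- ?f 1 2 * U$3 + U$7) * (- iw * (l * ?f 1 2 + iw * ?f 2 2))"
    unfolding sum_7 matrix_vector_mult_def map_matrix_def A1_def interior_null_vector_def Let_def iw_def
    by (simp add: vector_7 del: mult_minus_left mult_minus_right)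
  also have "\<dots> = c * (- ?b * q / 2) * (s + l) * (?b * l\<^sup>2 - iw\<^sup>2 * (of_real R * (of_real (M\<^sup>2) - (?f 1 1)\<^sup>2 - (?f 1 2)\<^sup>2) - 1))"
  proof -
    have "of_real (M\<^sup>2) * q = 1" "of_real R * r = 1"
      using M R by (simp_all add: q_def r_def)
    moreover have "complex_of_real (ell0 F) = ?f 1 1 * ?f 2 1 + ?f 1 2 * ?f 2 2"
      by (simp add: ell0_def)
    moreover have "?b = 1 + (?f 1 1)\<^sup>2 + (?f 1 2)\<^sup>2 - of_real (M\<^sup>2)"
      unfolding b star by simp
    moreover have "complex_of_real (d0 M F) = (1 + (?f 1 1)\<^sup>2 + (?f 1 2)\<^sup>2 + of_real (M\<^sup>2)) * q / 2"
      unfolding d0_def star q_def by simp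
    moreover have "complex_of_real (ell0 F / (M\<^sup>2 * R)) = of_real (ell0 F) * q * r"
      unfolding q_def r_def by simp
    moreover have "complex_of_real (a0 M R F) = - (?b * of_real R * q / 2)"
      unfolding a0_def q_def by simp
    moreover have "U$1 = c * (s - iw * of_real (ell0 F) * q)"
      unfolding c(1) q_def iw_def by simp
    moreover have "U$3 = c * (iw * of_real (a0 M R F))"
      unfolding c(3) iw_def by simp
    moreover have "elastic M F s l w = of_real (M\<^sup>2) * (s + l)\<^sup>2 - ((l * ?f 1 1 + iw * ?f 2 1)\<^sup>2 + (l * ?f 1 2 + iw * ?f 2 2)\<^sup>2)"
      unfolding elastic_def iw_def by simp
    moreover have "elastic M F s l w = l\<^sup>2 + iw\<^sup>2"
      unfolding K iw_def by (simp add: power_mult_distrib)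
    ultimately have 1: "(U$1 + (- of_real (d0 M F) * U$1 + of_real (ell0 F / (M\<^sup>2 * R)) * U$3)) * elastic M F s l w
    + (U$1 + of_real (M\<^sup>2) * (- of_real (d0 M F) * U$1 + of_real (ell0 F / (M\<^sup>2 * R)) * U$3) - ?f 1 1 * (- ?f 1 1 * U$1 + ?f 2 1 * r * U$3) - ?f 1 2 * (- ?f 1 2 * U$1 + ?f 2 2 * r * U$3)) * (- l * (s + l))
    + (of_real (M\<^sup>2) * U$3 - ?f 1 1 * (?f 1 1 * U$3) - ?f 1 2 * (?f 1 2 * U$3)) * (- iw * (s + l))
    + (- ?f 1 1 * (- of_real (d0 M F) * U$1 + of_real (ell0 F / (M\<^sup>2 * R)) * U$3) + (- ?f 1 1 * U$1 + ?f 2 1 * r * U$3)) * (- l * (l * ?f 1 1 + iw * ?f 2 1))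
    + (- ?f 1 2 * (- of_real (d0 M F) * U$1 + of_real (ell0 F / (M\<^sup>2 * R)) * U$3) + (- ?f 1 2 * U$1 + ?f 2 2 * r * U$3)) * (- l * (l * ?f 1 2 + iw * ?f 2 2))
    = c * (- ?b * q / 2) * (s + l) * (?b * l\<^sup>2 - iw\<^sup>2 * (of_real R * (of_real (M\<^sup>2) - (?f 1 1)\<^sup>2 - (?f 1 2)\<^sup>2) - 1))"
      by (rule lopatinski_pairing_algebra)
    have fr: "complex_of_real (F$2$j / R) = ?f 2 j * r" for j
      by (simp add: r_def)
    \<comment> \<open>These are the fifth and seventh entries of \<open>A1\<close> applied to
      \<open>U\<close>.\<close>
    have 0: "- ?f 1 1 * U$3 + ?f 1 1 * U$3 = 0" "- ?f 1 2 * U$3 + ?f 1 2 * U$3 = 0"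
      by simp_all
    show ?thesis
      unfolding c(2) c(4-7) fr 0 mult_zero_left add_0_right by (rule 1)
  qed
  finally have *: "(\<Sum>i\<in>UNIV. (map_matrix complex_of_real (A1 M F) *v U) $ i * interior_null_vector M F s l w $ i)
    = c * (- ?b * q / 2) * (s + l) * (?b * l\<^sup>2 - iw\<^sup>2 * (of_real R * (of_real (M\<^sup>2) - (?f 1 1)\<^sup>2 - (?f 1 2)\<^sup>2) - 1))" .
  have "c * (- ?b * q / 2) * (s + l) \<noteq> 0"
    using \<open>c \<noteq> 0\<close> b(2) M \<sigma> by (simp add: q_def)
  moreover have "iw\<^sup>2 * (of_real R * (of_real (M\<^sup>2) - (?f 1 1)\<^sup>2 - (?f 1 2)\<^sup>2) - 1)
    = of_real (w\<^sup>2 * (1 - R * (M\<^sup>2 - (M_one F)\<^sup>2)))"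
  proof -
    have "iw\<^sup>2 = - of_real (w\<^sup>2)"
      by (simp add: iw_def power_mult_distrib)
    then show ?thesis
      unfolding one by (simp add: algebra_simps)
  qed
  ultimately show ?thesis
    unfolding U_def[symmetric] * by simp
qed

subsection \<open>The acoustic root\<close>

lemma Re_csqrt_nonneg: "Re (csqrt z) \<ge> 0"
  using csqrt_principal[of z] by auto

text \<open>The real part of a square is \<open>Re^2 - Im^2\<close>, so the root stays within angle
  pi/4 of the positive axis.\<close>

lemma abs_Im_csqrt_le:
  assumes "Re z \<ge> 0"
  shows "\<bar>Im (csqrt z)\<bar> \<le> Re (csqrt z)"
proof -
  have "Re ((csqrt z)\<^sup>2) \<ge> 0" using assms by (simp only: power2_csqrt)
  then have "\<bar>Im (csqrt z)\<bar>\<^sup>2 \<le> (Re (csqrt z))\<^sup>2" by (simp only: Re_power2 power2_abs)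
  then show ?thesis using Re_csqrt_nonneg by (rule power2_le_imp_le)
qed

lemma abs_Im_csqrt_less:
  assumes "Re z > 0"
  shows "\<bar>Im (csqrt z)\<bar> < Re (csqrt z)"
proof -
  have "Re ((csqrt z)\<^sup>2) > 0" using assms by (simp only: power2_csqrt)
  then have "\<bar>Im (csqrt z)\<bar>\<^sup>2 < (Re (csqrt z))\<^sup>2" by (simp only: Re_power2 power2_abs)
  then show ?thesis using Re_csqrt_nonneg by (rule power2_less_imp_less)
qed

text \<open>Two angles of size at most pi/4 add up to at most pi/2.\<close>

lemma Re_csqrt_mult_nonneg:
  assumes "Re a \<ge> 0" "Re b \<ge> 0"
  shows "Re (csqrt a * csqrt b) \<ge> 0"
proof -
  have "Im (csqrt a) * Im (csqrt b) \<le> \<bar>Im (csqrt a)\<bar> * \<bar>Im (csqrt b)\<bar>"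
    unfolding abs_mult[symmetric] by (rule abs_ge_self)
  also have "\<dots> \<le> Re (csqrt a) * Re (csqrt b)"
    using abs_Im_csqrt_le[OF assms(1)] abs_Im_csqrt_le[OF assms(2)]
    by (intro mult_mono Re_csqrt_nonneg abs_ge_zero)
  finally show ?thesis by (simp del: csqrt.sel)
qed

lemma Re_csqrt_mult_pos:
  assumes "Re a > 0" "Re b > 0"
  shows "Re (csqrt a * csqrt b) > 0"
proof -
  have "Im (csqrt a) * Im (csqrt b) \<le> \<bar>Im (csqrt a)\<bar> * \<bar>Im (csqrt b)\<bar>"
    unfolding abs_mult[symmetric] by (rule abs_ge_self)
  also have "\<dots> < Re (csqrt a) * Re (csqrt b)"
    using abs_Im_csqrt_less[OF assms(1)] abs_Im_csqrt_less[OF assms(2)]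
    by (intro mult_strict_mono' abs_ge_zero)
  finally show ?thesis by (simp del: csqrt.sel)
qed

text \<open>The branch cut meets the closed right half plane only at 0, where the modulus of the
  root is the square root of the modulus.\<close>

lemma tendsto_csqrt_Re_nonneg:
  assumes f: "(f \<longlongrightarrow> z) F" and "Re z \<ge> 0"
  shows "((\<lambda>x. csqrt (f x)) \<longlongrightarrow> csqrt z) F"
proof (cases "z = 0")
  case True
  have "((\<lambda>x. sqrt (cmod (f x))) \<longlongrightarrow> sqrt (cmod 0)) F"
    using f True by (intro tendsto_real_sqrt tendsto_norm) simp
  then have "((\<lambda>x. cmod (csqrt (f x))) \<longlongrightarrow> 0) F"
    by simp
  then show ?thesis
    using True tendsto_norm_zero_cancel by fastforce
next
  case False
  then have "z \<notin> \<real>\<^sub>\<le>\<^sub>0"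
    using assms(2) by (auto simp: complex_nonpos_Reals_iff complex_eq_iff)
  with f show ?thesis
    by (intro isCont_tendsto_compose[OF continuous_at_csqrt])
qed

lemma csqrt_imaginary:
  "y \<ge> 0 \<Longrightarrow> Im (csqrt (\<i> * of_real y)) \<ge> 0" "y \<le> 0 \<Longrightarrow> Im (csqrt (\<i> * of_real y)) \<le> 0"
  by (auto simp: sgn_if)

text \<open>Both roots lie in the closed first quadrant. This fixes the branch of the discriminant
  root at purely imaginary frequencies.\<close>

lemma Im_csqrt_mult_imaginary_nonneg:
  assumes "a \<ge> 0" "b \<ge> 0"
  shows "Im (csqrt (\<i> * of_real a) * csqrt (\<i> * of_real b)) \<ge> 0"
  using csqrt_imaginary(1)[OF assms(1)] csqrt_imaginary(1)[OF assms(2)] Re_csqrt_nonneg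
  by (simp del: csqrt.sel)

lemma Im_csqrt_mult_imaginary_nonpos:
  assumes "a \<le> 0" "b \<le> 0"
  shows "Im (csqrt (\<i> * of_real a) * csqrt (\<i> * of_real b)) \<le> 0"
  using csqrt_imaginary(2)[OF assms(1)] csqrt_imaginary(2)[OF assms(2)] Re_csqrt_nonneg
  by (simp del: csqrt.sel add: mult_nonneg_nonpos mult_nonpos_nonneg add_nonpos_nonpos)

text \<open>If \<open>K = 0\<close>, its imaginary part and the Cauchy-Schwarz inequality bound a
  product of two quantities by the product of the same quantities each reduced by
  \<open>P > 0\<close>.\<close>

lemma elastic_nonzero:
  assumes M: "(M_one F)\<^sup>2 < M\<^sup>2" and s: "Re s \<ge> 0" and l: "Re l > 0"
  shows "elastic M F s l w \<noteq> 0"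
proof
  assume "elastic M F s l w = 0"
  define x where "x = Re l"
  define X where "X = Re (s + l)"
  define Y where "Y = Im (s + l)"
  define h1 where "h1 = Im l * F$1$1 + w * F$2$1"
  define h2 where "h2 = Im l * F$1$2 + w * F$2$2"
  define m where "m = (F$1$1)\<^sup>2 + (F$1$2)\<^sup>2"
  have re: "M\<^sup>2 * X\<^sup>2 - M\<^sup>2 * Y\<^sup>2 = x\<^sup>2 * m - (h1\<^sup>2 + h2\<^sup>2)"
    using arg_cong[OF \<open>elastic M F s l w = 0\<close>, of Re]
    unfolding elastic_def x_def X_def Y_def h1_def h2_def m_def
    by (simp add: algebra_simps power2_eq_square del: of_real_power)
  have im: "M\<^sup>2 * X * Y = x * (F$1$1 * h1 + F$1$2 * h2)"
    using arg_cong[OF \<open>elastic M F s l w = 0\<close>, of Im]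
    unfolding elastic_def x_def X_def Y_def h1_def h2_def m_def
    by (simp add: algebra_simps power2_eq_square del: of_real_power)
  define P where "P = M\<^sup>2 * X\<^sup>2 - x\<^sup>2 * m"
  have x: "0 < x" "x \<le> X" using s l by (simp_all add: x_def X_def)
  have m: "0 \<le> m" "m < M\<^sup>2" using M by (simp_all add: m_def M_one_def)
  have "x\<^sup>2 * m < X\<^sup>2 * M\<^sup>2"
    using x m by (intro mult_le_less_imp_less) (auto intro: power_mono)
  then have P: "P > 0" by (simp add: P_def mult.commute)
  have hP: "h1\<^sup>2 + h2\<^sup>2 = M\<^sup>2 * Y\<^sup>2 - P" using re by (simp add: P_def)
  have xP: "x\<^sup>2 * m = M\<^sup>2 * X\<^sup>2 - P" by (simp add: P_def)
  \<comment> \<open>Cauchy-Schwarz: the difference of the two sides is the square inserted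
    here.\<close>
  have "(F$1$1 * h1 + F$1$2 * h2)\<^sup>2 \<le> m * (h1\<^sup>2 + h2\<^sup>2)"
    using zero_le_power2[of "F$1$1 * h2 - F$1$2 * h1"] unfolding m_def
    by (simp add: power2_eq_square algebra_simps)
  then have "x\<^sup>2 * (F$1$1 * h1 + F$1$2 * h2)\<^sup>2 \<le> x\<^sup>2 * (m * (h1\<^sup>2 + h2\<^sup>2))"
    by (intro mult_left_mono) auto
  then have "(M\<^sup>2 * X\<^sup>2) * (M\<^sup>2 * Y\<^sup>2) \<le> (M\<^sup>2 * X\<^sup>2 - P) * (M\<^sup>2 * Y\<^sup>2 - P)"
    unfolding hP[symmetric] xP[symmetric] using arg_cong[OF im, of "\<lambda>x. x\<^sup>2"]
    by (simp add: power_mult_distrib algebra_simps power2_eq_square)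
  moreover have "M\<^sup>2 * Y\<^sup>2 - P \<ge> 0" using hP[symmetric] by simp
  moreover have "M\<^sup>2 * X\<^sup>2 - P \<ge> 0" using xP[symmetric] m by simp
  ultimately show False
    using P by (smt (verit, best) mult_less_cancel_left mult_mono mult_pos_pos mult_strict_mono)
qed


section \<open>Downstream shock data and the roots of the acoustic quadratic\<close>

locale shock_data =
  fixes M R :: real and F :: "real^2^2"
  assumes R_pos: "0 < R" and M_one_less: "M_one F < M" and less_M_star: "M < M_star F"
begin

text \<open>
  \<open>N = M\<^sub>*\<^sup>2\<close>, \<open>b2 = \<beta>\<^sup>2\<close>, \<open>h = \<ell>\<^sub>0\<close> and \<open>\<Delta> = 1 + \<F>:\<F> + (det \<F>)\<^sup>2\<close>.
\<close>

abbreviation "m \<equiv> (F$1$1)\<^sup>2 + (F$1$2)\<^sup>2"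
abbreviation "N \<equiv> 1 + m"
abbreviation "n \<equiv> (F$2$1)\<^sup>2 + (F$2$2)\<^sup>2"
abbreviation "b2 \<equiv> N - M\<^sup>2"
abbreviation "h \<equiv> F$1$1 * F$2$1 + F$1$2 * F$2$2"
abbreviation "\<Delta> \<equiv> N * (1 + n) - h\<^sup>2"
text \<open>The radical of the stability inequality. It also locates the branch points of the
  acoustic root on the imaginary axis, which is how it enters the criterion.\<close>

definition "G = sqrt (b2 * \<Delta>)"

lemma m_less: "m < M\<^sup>2"
  using power_strict_mono[OF M_one_less, of 2] by (simp add: M_one_def)

lemma M_pos: "0 < M"
  using M_one_less by (rule le_less_trans[rotated]) (simp add: M_one_def)

lemma M_less: "M\<^sup>2 < N"
  using power_strict_mono[OF less_M_star, of 2] M_pos by (simp add: M_star_def add_nonneg_nonneg)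

lemma beta_sq: "(beta M F)\<^sup>2 = b2" "beta M F \<noteq> 0"
  using M_less by (simp_all add: beta_def M_star_def add_nonneg_nonneg)

text \<open>Lagrange's identity: the difference \<open>m * n - h^2\<close> is the square of the
  determinant of \<open>F\<close>.\<close>

lemma h_sq_le: "h\<^sup>2 \<le> m * n"
  using zero_le_power2[of "F$1$1 * F$2$2 - F$1$2 * F$2$1"]
  by (simp add: power2_eq_square algebra_simps)

lemma h_sq_le_M: "h\<^sup>2 \<le> M\<^sup>2 * n"
  using h_sq_le m_less by (elim order_trans, intro mult_right_mono) auto

lemma \<Delta>_pos: "0 < \<Delta>"
proof -
  have "\<Delta> = 1 + m + n + (m * n - h\<^sup>2)" by (simp add: algebra_simps)
  moreover have "0 \<le> m" "0 \<le> n" by simp_all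
  ultimately show ?thesis using h_sq_le by linarith
qed

lemma G_pos: "0 < G"
  unfolding G_def using \<Delta>_pos M_less by simp

lemma G_sq: "G\<^sup>2 = b2 * \<Delta>"
  unfolding G_def using \<Delta>_pos M_less by simp

text \<open>
  A square root of \<open>z\<^sup>2 + G\<^sup>2w\<^sup>2\<close>. Taking the roots of the two linear factors separately keeps both
  arguments in the closed right half plane, where \<open>csqrt\<close> is continuous. Hence the formula for
  \<open>\<lambda>\<^sup>+\<close> extends to \<open>\<eta> = 0\<close> and gives the limit there, although the product crosses the branch cut.
\<close>

definition root_discriminant :: "complex \<Rightarrow> real \<Rightarrow> complex" where
  "root_discriminant s w =
     (let z = of_real M * (of_real N * s - \<i> * of_real (w * h))
      in csqrt (z + \<i> * of_real (G * w)) * csqrt (z - \<i> * of_real (G * w)))"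

definition acoustic_root :: "complex \<Rightarrow> real \<Rightarrow> complex" where
  "acoustic_root s w =
     (of_real (M\<^sup>2) * s - \<i> * of_real (w * h) + root_discriminant s w / of_real (sqrt N)) / of_real b2"

lemma root_discriminant_sq:
  "(root_discriminant s w)\<^sup>2 =
     (of_real M * (of_real N * s - \<i> * of_real (w * h)))\<^sup>2 + of_real (w\<^sup>2 * (b2 * \<Delta>))"
proof -
  have "(\<i> * complex_of_real (G * w))\<^sup>2 = - of_real (w\<^sup>2 * G\<^sup>2)"
    by (simp add: power_mult_distrib)
  then show ?thesis
    unfolding root_discriminant_def Let_def power_mult_distrib power2_csqrt G_sq
    by (simp add: algebra_simps power2_eq_square)
qed

lemma Re_acoustic_arg: "Re (of_real M * (of_real N * s - \<i> * of_real (w * h)) + \<i> * of_real y) = M * N * Re s"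
  "Re (of_real M * (of_real N * s - \<i> * of_real (w * h)) - \<i> * of_real y) = M * N * Re s"
  by simp_all

lemma N_pos: "0 < N"
  by (simp add: add_pos_nonneg)

lemma Re_root_discriminant_nonneg: "0 \<le> Re s \<Longrightarrow> 0 \<le> Re (root_discriminant s w)"
  unfolding root_discriminant_def Let_def using M_pos N_pos
  by (intro Re_csqrt_mult_nonneg; subst Re_acoustic_arg; intro mult_nonneg_nonneg; simp)

lemma Re_root_discriminant_pos: "0 < Re s \<Longrightarrow> 0 < Re (root_discriminant s w)"
  unfolding root_discriminant_def Let_def using M_pos N_pos
  by (intro Re_csqrt_mult_pos; subst Re_acoustic_arg; intro mult_pos_pos; simp)

lemma acoustic_iff:
  "elastic M F s l w = l\<^sup>2 - of_real (w\<^sup>2) \<longleftrightarrow>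
    of_real b2 * l\<^sup>2 - 2 * (of_real (M\<^sup>2) * s - \<i> * of_real (w * h)) * l
      - of_real (M\<^sup>2) * s\<^sup>2 - of_real (w\<^sup>2 * (1 + n)) = 0"
proof -
  have "l\<^sup>2 - of_real (w\<^sup>2) - elastic M F s l w =
    of_real b2 * l\<^sup>2 - 2 * (of_real (M\<^sup>2) * s - \<i> * of_real (w * h)) * l
      - of_real (M\<^sup>2) * s\<^sup>2 - of_real (w\<^sup>2 * (1 + n))"
    unfolding elastic_def by (simp add: algebra_simps power2_eq_square)
  then show ?thesis by (metis eq_iff_diff_eq_0)
qed

text \<open>The quadratic formula. Multiplying the reduced discriminant by \<open>N\<close>
  completes the square in \<open>s\<close>, which yields the square of
  \<open>root_discriminant\<close>.\<close>

lemma acoustic_iff_root: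
  "elastic M F s l w = l\<^sup>2 - of_real (w\<^sup>2) \<longleftrightarrow>
    l = acoustic_root s w \<or>
    l = (of_real (M\<^sup>2) * s - \<i> * of_real (w * h) - root_discriminant s w / of_real (sqrt N)) / of_real b2"
proof -
  define B where "B = of_real (M\<^sup>2) * s - \<i> * of_real (w * h)"
  define S where "S = root_discriminant s w / of_real (sqrt N)"
  have b2: "complex_of_real b2 \<noteq> 0"
    using M_less by (metis diff_gt_0_iff_gt less_irrefl of_real_eq_0_iff)
  have N: "complex_of_real N \<noteq> 0"
    using N_pos by (metis less_irrefl of_real_eq_0_iff)
  have SN: "(complex_of_real (sqrt N))\<^sup>2 = of_real N"
    using N_pos by (metis less_eq_real_def of_real_power real_sqrt_pow2)
  have NS: "of_real N * S\<^sup>2 = (of_real M * (of_real N * s - \<i> * of_real (w * h)))\<^sup>2 + of_real (w\<^sup>2 * (b2 * \<Delta>))"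
    unfolding S_def power_divide SN root_discriminant_sq using N by simp
  also have "\<dots> = of_real N * (B\<^sup>2 + of_real b2 * (of_real (M\<^sup>2) * s\<^sup>2 + of_real (w\<^sup>2 * (1 + n))))"
  proof -
    \<comment> \<open>Over abstract variables, with \<open>i * i = -1\<close> as the only relation,
      this is within reach of \<open>algebra\<close>.\<close>
    have "\<And>N M2 h n w i s :: complex. i * i = -1 \<Longrightarrow>
      M2 * (N * s - i * (w * h))\<^sup>2 + w\<^sup>2 * ((N - M2) * (N * (1 + n) - h\<^sup>2))
      = N * ((M2 * s - i * (w * h))\<^sup>2 + (N - M2) * (M2 * s\<^sup>2 + w\<^sup>2 * (1 + n)))"
      by algebra
    from this[of \<i> "of_real (M\<^sup>2)" "of_real N" s "of_real w" "of_real h" "of_real n"]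
    show ?thesis unfolding B_def by (simp add: power_mult_distrib)
  qed
  finally have S: "S\<^sup>2 = B\<^sup>2 + of_real b2 * (of_real (M\<^sup>2) * s\<^sup>2 + of_real (w\<^sup>2 * (1 + n)))"
    using N by (metis mult_left_cancel)
  have "of_real b2 * (of_real b2 * l\<^sup>2 - 2 * B * l - of_real (M\<^sup>2) * s\<^sup>2 - of_real (w\<^sup>2 * (1 + n)))
    = (of_real b2 * l - (B + S)) * (of_real b2 * l - (B - S))"
    using S by algebra
  then have "of_real b2 * l\<^sup>2 - 2 * B * l - of_real (M\<^sup>2) * s\<^sup>2 - of_real (w\<^sup>2 * (1 + n)) = 0
    \<longleftrightarrow> of_real b2 * l = B + S \<or> of_real b2 * l = B - S"
    using b2 by (metis eq_iff_diff_eq_0 mult_eq_0_iff)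
  also have "\<dots> \<longleftrightarrow> l = (B + S) / of_real b2 \<or> l = (B - S) / of_real b2"
  proof -
    have "of_real b2 * l = x \<longleftrightarrow> l = x / of_real b2" for x
      using b2 by (metis nonzero_eq_divide_eq mult.commute)
    then show ?thesis by (simp only:)
  qed
  finally show ?thesis
    unfolding acoustic_iff acoustic_root_def B_def S_def .
qed

lemmas acoustic_root = acoustic_iff_root[THEN iffD2, OF disjI1, OF refl]

lemma Re_acoustic_root_nonneg: "0 \<le> Re s \<Longrightarrow> 0 \<le> Re (acoustic_root s w)"
  and Re_acoustic_root_pos: "0 < Re s \<Longrightarrow> 0 < Re (acoustic_root s w)"
proof -
  have *: "Re (acoustic_root s w) = (M\<^sup>2 * Re s + Re (root_discriminant s w) / sqrt N) / b2"
    unfolding acoustic_root_def by (simp only: Re_divide_of_real plus_complex.sel minus_complex.sel) simp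
  have "0 < sqrt N" using N_pos by simp
  show "0 \<le> Re s \<Longrightarrow> 0 \<le> Re (acoustic_root s w)"
    unfolding * using Re_root_discriminant_nonneg[of s w] \<open>0 < sqrt N\<close> M_less
    by (intro divide_nonneg_nonneg add_nonneg_nonneg mult_nonneg_nonneg) auto
  show "0 < Re s \<Longrightarrow> 0 < Re (acoustic_root s w)"
    unfolding * using Re_root_discriminant_pos[of s w] \<open>0 < sqrt N\<close> M_less
    by (intro divide_pos_pos add_nonneg_pos mult_nonneg_nonneg) auto
qed

text \<open>Needed for uniqueness of the root in the right half plane. It combines
  \<open>Re z \<le> Re S\<close> with \<open>M < sqrt N\<close>, which gives
  \<open>M^2 * Re s < Re S / sqrt N\<close>.\<close>

lemma Re_other_root_neg:
  assumes s: "0 < Re s"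
  shows "Re ((of_real (M\<^sup>2) * s - \<i> * of_real (w * h) - root_discriminant s w / of_real (sqrt N)) / of_real b2) < 0"
proof -
  define S where "S = root_discriminant s w"
  define z where "z = of_real M * (of_real N * s - \<i> * of_real (w * h))"
  have x: "Re z = M * N * Re s" by (simp add: z_def)
  then have "Re z > 0" using s M_pos N_pos by simp
  have S: "Re S > 0" using Re_root_discriminant_pos[OF s] by (simp add: S_def)
  define r where "r = w\<^sup>2 * (b2 * \<Delta>)"
  have "r \<ge> 0" unfolding r_def using M_less \<Delta>_pos by (intro mult_nonneg_nonneg) auto
  have eq: "S\<^sup>2 = z\<^sup>2 + of_real r"
    by (simp add: S_def z_def r_def root_discriminant_sq)
  have re: "(Re S)\<^sup>2 - (Im S)\<^sup>2 = (Re z)\<^sup>2 - (Im z)\<^sup>2 + r"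
    using arg_cong[OF eq, of Re] by (simp add: Re_power2)
  have im: "Re S * Im S = Re z * Im z"
    using arg_cong[OF eq, of Im] by (simp add: Im_power2)
  \<comment> \<open>\<open>S\<close> and \<open>z\<close> have the same product of real and
    imaginary part. A smaller real part of \<open>S\<close> would force an imaginary part at least
    as large in modulus, making \<open>Re (S^2)\<close> less than \<open>Re (z^2)\<close>, against
    \<open>r \<ge> 0\<close>.\<close>
  have "Re z \<le> Re S"
  proof (rule ccontr)
    assume "\<not> Re z \<le> Re S"
    then have "Re S < Re z" by simp
    then have 1: "(Re S)\<^sup>2 < (Re z)\<^sup>2" using S by (intro power_strict_mono) auto
    then have "(Re S)\<^sup>2 * (Im z)\<^sup>2 \<le> (Re z)\<^sup>2 * (Im z)\<^sup>2" by (intro mult_right_mono) auto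
    also have "\<dots> = (Re S)\<^sup>2 * (Im S)\<^sup>2" using im by (metis power_mult_distrib)
    finally have "(Im z)\<^sup>2 \<le> (Im S)\<^sup>2" using S by simp
    then show False using re 1 \<open>r \<ge> 0\<close> by linarith
  qed
  have "0 < sqrt N" using N_pos by simp
  have "M < sqrt N" using M_less M_pos by (simp add: real_less_rsqrt)
  then have "M * sqrt N < sqrt N * sqrt N" using \<open>0 < sqrt N\<close> by (rule mult_strict_right_mono)
  then have "M * sqrt N < N" using N_pos by (simp only: real_sqrt_mult_self abs_of_pos)
  then have "M * (M * sqrt N) * Re s < M * N * Re s"
    using M_pos s by (intro mult_strict_right_mono mult_strict_left_mono)
  then have "M\<^sup>2 * Re s * sqrt N < Re S"
    using \<open>Re z \<le> Re S\<close> x by (simp add: power2_eq_square algebra_simps)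
  then have "M\<^sup>2 * Re s < Re S / sqrt N"
    using \<open>0 < sqrt N\<close> by (simp add: pos_less_divide_eq)
  then have "(M\<^sup>2 * Re s - Re S / sqrt N) / b2 < 0"
    using M_less by (simp add: divide_neg_pos)
  moreover have "Re ((of_real (M\<^sup>2) * s - \<i> * of_real (w * h) - S / of_real (sqrt N)) / of_real b2)
      = (M\<^sup>2 * Re s - Re S / sqrt N) / b2"
    by (simp only: Re_divide_of_real plus_complex.sel minus_complex.sel) simp
  ultimately show ?thesis by (simp only: S_def)
qed

section \<open>Identification of \<open>lambda_plus\<close> with the acoustic root\<close>

lemma interior_null_vector_nonzero:
  "elastic M F s l w \<noteq> 0 \<Longrightarrow> interior_null_vector M F s l w \<noteq> 0"
  by (auto simp: vec_eq_iff forall_7 interior_null_vector_def Let_def vector_7)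

text \<open>With \<open>Re l > 0\<close> neither \<open>s + l\<close> nor \<open>K\<close> vanishes,
  so the acoustic branch is the only source of kernel vectors.\<close>

lemma det_interior_symbol_eq_0_iff:
  assumes "0 \<le> Re s" "0 < Re l"
  shows "det (interior_symbol M F s l w) = 0 \<longleftrightarrow> elastic M F s l w = l\<^sup>2 - of_real (w\<^sup>2)"
proof -
  have "s + l \<noteq> 0" using assms by (metis add_nonneg_pos less_irrefl plus_complex.sel(1) zero_complex.sel(1))
  moreover have "elastic M F s l w \<noteq> 0"
    using assms m_less by (intro elastic_nonzero) (simp_all add: M_one_def)
  ultimately show ?thesis
    unfolding det_eq_0_iff_kernel
    using interior_symbol_kernel(2) interior_symbol_null_vector interior_null_vector_nonzero by blast
qed

lemma lambda_interior_eq: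
  assumes "0 < \<eta>"
  shows "lambda_interior M F \<eta> \<xi> w = acoustic_root (Complex \<eta> \<xi>) w"
  unfolding lambda_interior_def
proof (rule the_equality)
  have s: "0 < Re (Complex \<eta> \<xi>)" using assms by simp
  show "det (interior_symbol M F (Complex \<eta> \<xi>) (acoustic_root (Complex \<eta> \<xi>) w) w) = 0 \<and>
    0 < Re (acoustic_root (Complex \<eta> \<xi>) w)"
    using det_interior_symbol_eq_0_iff acoustic_root Re_acoustic_root_pos[OF s] s by auto
  fix l assume l: "det (interior_symbol M F (Complex \<eta> \<xi>) l w) = 0 \<and> 0 < Re l"
  then have "elastic M F (Complex \<eta> \<xi>) l w = l\<^sup>2 - of_real (w\<^sup>2)"
    using det_interior_symbol_eq_0_iff s by (metis less_imp_le)
  then show "l = acoustic_root (Complex \<eta> \<xi>) w"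
    using l Re_other_root_neg[OF s, of w] unfolding acoustic_iff_root by (metis less_asym)
qed

lemma tendsto_acoustic_root:
  "((\<lambda>\<eta>. acoustic_root (Complex \<eta> \<xi>) w) \<longlongrightarrow> acoustic_root (Complex 0 \<xi>) w) (at_right 0)"
proof -
  have c: "((\<lambda>\<eta>. Complex \<eta> \<xi>) \<longlongrightarrow> Complex 0 \<xi>) (at_right 0)"
    by (intro tendsto_Complex tendsto_intros)
  have "((\<lambda>\<eta>. root_discriminant (Complex \<eta> \<xi>) w) \<longlongrightarrow> root_discriminant (Complex 0 \<xi>) w) (at_right 0)"
    unfolding root_discriminant_def Let_def
    by (intro tendsto_mult tendsto_csqrt_Re_nonneg tendsto_add tendsto_diff tendsto_const c)
      (simp_all only: Re_acoustic_arg complex.sel mult_zero_right order_refl)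
  moreover have "of_real (sqrt N) \<noteq> (0::complex)" "of_real b2 \<noteq> (0::complex)"
    using N_pos M_less by (simp_all only: of_real_eq_0_iff real_sqrt_eq_0_iff)
  ultimately show ?thesis
    unfolding acoustic_root_def
    by (intro tendsto_divide tendsto_add tendsto_diff tendsto_mult tendsto_const c)
qed

lemma lambda_plus_eq:
  assumes "0 \<le> \<eta>"
  shows "lambda_plus M F \<eta> \<xi> w = acoustic_root (Complex \<eta> \<xi>) w"
proof (cases "\<eta> = 0")
  case True
  have "\<forall>\<^sub>F \<eta> in at_right 0. acoustic_root (Complex \<eta> \<xi>) w = lambda_interior M F \<eta> \<xi> w"
    using lambda_interior_eq eventually_at_right_less[of "0::real"] by (auto elim: eventually_mono)
  then have "((\<lambda>\<eta>. lambda_interior M F \<eta> \<xi> w) \<longlongrightarrow> acoustic_root (Complex 0 \<xi>) w) (at_right 0)"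
    using tendsto_acoustic_root by (rule Lim_transform_eventually[rotated])
  then show ?thesis
    using True by (simp add: lambda_plus_def tendsto_Lim)
next
  case False
  then show ?thesis using assms by (simp add: lambda_plus_def lambda_interior_eq)
qed

subsection \<open>Zeros of the Lopatinski determinant\<close>

text \<open>Only \<open>Re l = 0\<close>, hence \<open>Re s = 0\<close>, is delicate. Then
  \<open>l = \<i> * y\<close> and \<open>K = - (y^2 + w^2)\<close>, so \<open>K = 0\<close> would
  give \<open>y = w = 0\<close> and \<open>s = 0\<close>. If \<open>s + l = 0\<close>, then
  \<open>K\<close> is also a sum of squares, hence 0, which is already excluded.\<close>

lemma acoustic_root_nondegenerate:
  assumes s: "0 \<le> Re s" and sw: "s \<noteq> 0 \<or> w \<noteq> 0"
  defines "l \<equiv> acoustic_root s w"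
  shows "s + l \<noteq> 0" and "elastic M F s l w \<noteq> 0"
proof -
  have K: "elastic M F s l w = l\<^sup>2 - of_real (w\<^sup>2)"
    unfolding l_def by (rule acoustic_root)
  have "s + l \<noteq> 0 \<and> elastic M F s l w \<noteq> 0"
  proof (cases "Re l > 0")
    case True
    then have "Re (s + l) > 0" using s by simp
    then have "s + l \<noteq> 0" by (metis less_irrefl zero_complex.sel(1))
    then show ?thesis
      using elastic_nonzero[of F M s l w] s True m_less by (simp add: M_one_def)
  next
    case False
    then have "Re l = 0" using Re_acoustic_root_nonneg[OF s, of w] by (simp add: l_def)
    define y where "y = Im l"
    have l: "l = \<i> * of_real y" using \<open>Re l = 0\<close> by (simp add: complex_eq_iff y_def)
    have s0: "Re s = 0"
      using Re_acoustic_root_pos[of s w] s \<open>Re l = 0\<close> by (force simp: l_def)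
    have K': "elastic M F s l w = - of_real (y\<^sup>2 + w\<^sup>2)"
      unfolding K by (simp add: l power_mult_distrib)
    have "elastic M F s l w \<noteq> 0"
    proof
      assume 0: "elastic M F s l w = 0"
      then have "y\<^sup>2 + w\<^sup>2 = 0"
        unfolding K' by (simp only: neg_equal_0_iff_equal of_real_eq_0_iff)
      then have "y = 0" "w = 0" by simp_all
      then have "of_real (M\<^sup>2) * s\<^sup>2 = 0"
        using 0 unfolding l elastic_def by simp
      then show False using sw \<open>w = 0\<close> M_pos by simp
    qed
    moreover have "s + l \<noteq> 0"
    proof
      assume "s + l = 0"
      then have "elastic M F s l w = of_real ((y * F$1$1 + w * F$2$1)\<^sup>2 + (y * F$1$2 + w * F$2$2)\<^sup>2)"
        unfolding elastic_def l by (simp add: power2_eq_square algebra_simps)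
      then have "- (y\<^sup>2 + w\<^sup>2) = (y * F$1$1 + w * F$2$1)\<^sup>2 + (y * F$1$2 + w * F$2$2)\<^sup>2"
        unfolding K' by (simp only: of_real_minus[symmetric] of_real_eq_iff)
      moreover have "0 \<le> (y * F$1$1 + w * F$2$1)\<^sup>2" "0 \<le> (y * F$1$2 + w * F$2$2)\<^sup>2" "0 \<le> y\<^sup>2" "0 \<le> w\<^sup>2"
        by simp_all
      ultimately have "y\<^sup>2 = 0" "w\<^sup>2 = 0" by linarith+
      then show False using \<open>elastic M F s l w \<noteq> 0\<close> K' by simp
    qed
    ultimately show ?thesis by simp
  qed
  then show "s + l \<noteq> 0" and "elastic M F s l w \<noteq> 0" by simp_all
qed

definition Q :: real where "Q = 1 - R * (M\<^sup>2 - m)"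

text \<open>The kernel of the interior symbol remains one-dimensional up to
  \<open>\<eta> = 0\<close>, so one criterion serves both Lopatinski conditions.\<close>

lemma det_lopatinski_matrix_eq_0_iff:
  assumes \<eta>: "0 \<le> \<eta>" and nz: "\<eta>\<^sup>2 + \<xi>\<^sup>2 + w\<^sup>2 \<noteq> 0"
  shows "det (lopatinski_matrix M R F \<eta> \<xi> w) = 0 \<longleftrightarrow>
    of_real b2 * (acoustic_root (Complex \<eta> \<xi>) w)\<^sup>2 = of_real (w\<^sup>2 * Q)"
proof -
  define s where "s = Complex \<eta> \<xi>"
  define l where "l = acoustic_root s w"
  define S where "S = interior_symbol M F s l w"
  define X where "X = interior_null_vector M F s l w"
  define v where "v = map_matrix complex_of_real (A1 M F) *v boundary_null_vector M R F s w"
  have s: "0 \<le> Re s" "s \<noteq> 0 \<or> w \<noteq> 0" using \<eta> nz by (auto simp: s_def complex_eq_iff)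
  have K: "elastic M F s l w = l\<^sup>2 - of_real (w\<^sup>2)" unfolding l_def by (rule acoustic_root)
  have nd: "s + l \<noteq> 0" "elastic M F s l w \<noteq> 0"
    unfolding l_def using acoustic_root_nondegenerate[OF s] .
  have X: "S *v X = 0" "X \<noteq> 0"
    unfolding S_def X_def using interior_symbol_null_vector[OF K] interior_null_vector_nonzero[OF nd(2)] .
  have ker: "\<exists>c. Y = c *s X" if "S *v Y = 0" for Y
    using interior_symbol_kernel(1)[OF that[unfolded S_def] nd] unfolding X_def by blast
  have "\<exists>L. bordered_by S v L"
    using X ker by (intro bordered_by_exists) (simp_all add: S_def)
  from someI_ex[OF this] have L: "bordered_by S v (lopatinski_matrix M R F \<eta> \<xi> w)"
    unfolding lopatinski_matrix_def S_def v_def l_def s_def lambda_plus_eq[OF \<eta>] .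
  have "det (lopatinski_matrix M R F \<eta> \<xi> w) = 0 \<longleftrightarrow> (\<Sum>i\<in>UNIV. v $ i * X $ i) = 0"
    by (rule det_bordered_by_eq_0_iff[OF _ X(2) X(1) ker L]) (simp_all add: S_def)
  also have "\<dots> \<longleftrightarrow> of_real ((beta M F)\<^sup>2) * l\<^sup>2 = of_real (w\<^sup>2 * (1 - R * (M\<^sup>2 - (M_one F)\<^sup>2)))"
    unfolding v_def X_def
  proof (rule lopatinski_pairing[OF _ _ _ beta_sq(2) s(2) K nd(1)])
    show "(beta M F)\<^sup>2 = (M_star F)\<^sup>2 - M\<^sup>2"
      unfolding beta_sq by (simp add: M_star_def add_nonneg_nonneg)
  qed (use M_pos R_pos in auto)
  also have "(M_one F)\<^sup>2 = m" by (simp add: M_one_def)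
  finally show ?thesis
    unfolding beta_sq l_def s_def Q_def .
qed

section \<open>Critical frequencies and the range of the root on the imaginary axis\<close>

lemma b2_pos: "0 < b2"
  using M_less by simp

text \<open>
  A root with positive real part would be real, and the dispersion relation then bounds a
  nonnegative quantity by \<open>M\<^sup>2\<xi>\<^sup>2 - n\<omega>\<^sup>2 \<le> 0\<close>.
\<close>

lemma Re_critical_root:
  assumes s: "0 \<le> Re s" and crit: "of_real b2 * (acoustic_root s w)\<^sup>2 = of_real (w\<^sup>2 * Q)"
  shows "Re (acoustic_root s w) = 0"
proof (rule ccontr)
  define l where "l = acoustic_root s w"
  define x where "x = Re l"
  define \<eta> where "\<eta> = Re s"
  define \<xi> where "\<xi> = Im s"
  assume "Re (acoustic_root s w) \<noteq> 0"
  then have x: "0 < x" using Re_acoustic_root_nonneg[OF s, of w] by (simp add: x_def l_def)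
  have c: "of_real b2 * l\<^sup>2 = of_real (w\<^sup>2 * Q)" using crit by (simp only: l_def)
  have "Im (of_real b2 * l\<^sup>2) = b2 * (2 * x * Im l)"
    by (simp only: Im_complex_of_real complex.sel times_complex.sel Re_complex_of_real Im_power2 x_def)
  then have "b2 * (2 * x * Im l) = 0" unfolding c by (simp only: Im_complex_of_real)
  then have "Im l = 0" using x b2_pos by simp
  then have l: "l = of_real x" by (simp add: complex_eq_iff x_def)
  have "of_real (b2 * x\<^sup>2) = complex_of_real (w\<^sup>2 * Q)"
    using c unfolding l by (simp only: of_real_mult of_real_power)
  then have bx: "b2 * x\<^sup>2 = w\<^sup>2 * Q" by (simp only: of_real_eq_iff)
  have disp: "of_real b2 * l\<^sup>2 - 2 * (of_real (M\<^sup>2) * s - \<i> * of_real (w * h)) * l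
      - of_real (M\<^sup>2) * s\<^sup>2 - of_real (w\<^sup>2 * (1 + n)) = 0"
    using acoustic_root[of s w] unfolding acoustic_iff l_def .
  have re: "b2 * x\<^sup>2 - 2 * M\<^sup>2 * \<eta> * x - M\<^sup>2 * (\<eta>\<^sup>2 - \<xi>\<^sup>2) - w\<^sup>2 * (1 + n) = 0"
    using arg_cong[OF disp, of Re] unfolding l \<eta>_def \<xi>_def by (simp add: power2_eq_square algebra_simps)
  have im: "M\<^sup>2 * \<xi> * (x + \<eta>) = w * h * x"
    using arg_cong[OF disp, of Im] unfolding l \<eta>_def \<xi>_def by (simp add: power2_eq_square algebra_simps)
  have \<eta>: "0 \<le> \<eta>" using s by (simp add: \<eta>_def)
  have "(M\<^sup>2 * \<xi>)\<^sup>2 * x\<^sup>2 \<le> (M\<^sup>2 * \<xi>)\<^sup>2 * (x + \<eta>)\<^sup>2"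
    using x \<eta> by (intro mult_left_mono power_mono) auto
  also have "\<dots> = (w * h)\<^sup>2 * x\<^sup>2" using im by (metis power_mult_distrib)
  finally have "(M\<^sup>2 * \<xi>)\<^sup>2 \<le> (w * h)\<^sup>2" using x by simp
  also have "\<dots> \<le> w\<^sup>2 * (M\<^sup>2 * n)"
    unfolding power_mult_distrib[of w] using h_sq_le_M by (intro mult_left_mono) auto
  finally have "M\<^sup>2 * (M\<^sup>2 * \<xi>\<^sup>2) \<le> M\<^sup>2 * (w\<^sup>2 * n)"
    by (simp only: power2_eq_square mult_ac)
  then have "M\<^sup>2 * \<xi>\<^sup>2 \<le> w\<^sup>2 * n"
    by (rule mult_left_le_imp_le) (use M_pos in simp)
  moreover have "w\<^sup>2 * (R * (M\<^sup>2 - m)) + 2 * M\<^sup>2 * \<eta> * x + M\<^sup>2 * \<eta>\<^sup>2 = M\<^sup>2 * \<xi>\<^sup>2 - w\<^sup>2 * n"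
    using re unfolding bx Q_def by (simp add: algebra_simps)
  moreover have "0 \<le> 2 * M\<^sup>2 * \<eta> * x" "0 \<le> M\<^sup>2 * \<eta>\<^sup>2" using \<eta> x by simp_all
  ultimately have "w\<^sup>2 * (R * (M\<^sup>2 - m)) \<le> 0" by linarith
  moreover have "0 < R * (M\<^sup>2 - m)" using R_pos m_less by simp
  ultimately have "w = 0" by (metis mult_pos_pos not_le zero_less_power2)
  then show False using bx x b2_pos by simp
qed

lemma lopatinski: "lopatinski_condition M R F"
  unfolding lopatinski_condition_def
proof (intro allI impI notI)
  fix \<eta> \<xi> w :: real
  assume "\<eta> > 0" and "det (lopatinski_matrix M R F \<eta> \<xi> w) = 0"
  moreover have "\<eta>\<^sup>2 + \<xi>\<^sup>2 + w\<^sup>2 > 0" using \<open>\<eta> > 0\<close> by (intro add_pos_nonneg) auto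
  ultimately show False
    using det_lopatinski_matrix_eq_0_iff[of \<eta> \<xi> w] Re_critical_root[of "Complex \<eta> \<xi>" w]
      Re_acoustic_root_pos[of "Complex \<eta> \<xi>" w] by simp
qed

text \<open>Makes \<open>M * G - b2 * \<bar>h\<bar>\<close> positive, so that bounds on it may be
  squared and square roots taken. After squaring, the claim is
  \<open>N * (M^2 * (1 + n) - h^2) > 0\<close>.\<close>

lemma h_less_G: "b2 * \<bar>h\<bar> < M * G"
proof (rule power2_less_imp_less)
  have "N * (M\<^sup>2 * (1 + n) - h\<^sup>2) > 0"
    using N_pos h_sq_le_M M_pos by (intro mult_pos_pos) (auto simp: algebra_simps intro: add_strict_increasing)
  then have "b2 * h\<^sup>2 < M\<^sup>2 * \<Delta>" by (simp add: algebra_simps)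
  then have "b2 * (b2 * h\<^sup>2) < b2 * (M\<^sup>2 * \<Delta>)" using b2_pos by (rule mult_strict_left_mono)
  then show "(b2 * \<bar>h\<bar>)\<^sup>2 < (M * G)\<^sup>2"
    unfolding power_mult_distrib G_sq power2_abs by (simp only: power2_eq_square mult_ac)
  show "0 \<le> M * G" using M_pos G_pos by simp
qed

text \<open>At \<open>s = \<i> * \<xi>\<close> the square of \<open>S\<close> is real. Outside the
  band \<open>M * \<bar>\<tau>\<bar> < G * \<bar>w\<bar>\<close> the root \<open>S\<close> is
  imaginary, and the last two claims give its sign, which is the information kept from the limit
  \<open>\<eta> \<rightarrow> 0\<close>.\<close>

lemma acoustic_root_imaginary_frequency:
  fixes \<xi> w :: real
  defines "\<tau> \<equiv> N * \<xi> - w * h"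
  defines "S \<equiv> root_discriminant (Complex 0 \<xi>) w"
  shows "S\<^sup>2 = of_real (G\<^sup>2 * w\<^sup>2 - M\<^sup>2 * \<tau>\<^sup>2)"
    and "b2 * N * Im (acoustic_root (Complex 0 \<xi>) w) = M\<^sup>2 * \<tau> - b2 * (w * h) + sqrt N * Im S"
    and "b2 * sqrt N * Re (acoustic_root (Complex 0 \<xi>) w) = Re S"
    and "G * \<bar>w\<bar> \<le> M * \<tau> \<Longrightarrow> 0 \<le> Im S"
    and "M * \<tau> \<le> - (G * \<bar>w\<bar>) \<Longrightarrow> Im S \<le> 0"
proof -
  have z: "of_real N * Complex 0 \<xi> - \<i> * of_real (w * h) = \<i> * of_real \<tau>"
    by (simp add: complex_eq_iff \<tau>_def)
  have "(of_real M * (\<i> * complex_of_real \<tau>))\<^sup>2 = - of_real (M\<^sup>2 * \<tau>\<^sup>2)"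
    by (simp add: power_mult_distrib)
  then show "S\<^sup>2 = of_real (G\<^sup>2 * w\<^sup>2 - M\<^sup>2 * \<tau>\<^sup>2)"
    unfolding S_def root_discriminant_sq z G_sq by (simp only: of_real_diff mult.commute) simp
  have S: "S = csqrt (\<i> * of_real (M * \<tau> + G * w)) * csqrt (\<i> * of_real (M * \<tau> - G * w))"
    unfolding S_def root_discriminant_def Let_def z by (simp add: algebra_simps)
  have Gw: "\<bar>G * w\<bar> = G * \<bar>w\<bar>" using G_pos by (simp add: abs_mult)
  show "0 \<le> Im S" if "G * \<bar>w\<bar> \<le> M * \<tau>"
    unfolding S using that Gw by (intro Im_csqrt_mult_imaginary_nonneg) linarith+
  show "Im S \<le> 0" if "M * \<tau> \<le> - (G * \<bar>w\<bar>)"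
    unfolding S using that Gw by (intro Im_csqrt_mult_imaginary_nonpos) linarith+
  have sN: "0 < sqrt N" "sqrt N * sqrt N = N" using N_pos by simp_all
  have "Im (acoustic_root (Complex 0 \<xi>) w) = (M\<^sup>2 * \<xi> - w * h + Im S / sqrt N) / b2"
    unfolding acoustic_root_def S_def by (simp only: Im_divide_of_real plus_complex.sel minus_complex.sel) simp
  then have "b2 * Im (acoustic_root (Complex 0 \<xi>) w) = M\<^sup>2 * \<xi> - w * h + Im S / sqrt N"
    using b2_pos by simp
  then have "N * (b2 * Im (acoustic_root (Complex 0 \<xi>) w)) = M\<^sup>2 * (N * \<xi>) - N * (w * h) + Im S * (N / sqrt N)"
    by (simp only:) (simp add: algebra_simps)
  also have "N / sqrt N = sqrt N" using N_pos by (simp add: real_div_sqrt)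
  finally show "b2 * N * Im (acoustic_root (Complex 0 \<xi>) w) = M\<^sup>2 * \<tau> - b2 * (w * h) + sqrt N * Im S"
    unfolding \<tau>_def by (simp only: algebra_simps)
  have "Re (acoustic_root (Complex 0 \<xi>) w) = (Re S / sqrt N) / b2"
    unfolding acoustic_root_def S_def by (simp only: Re_divide_of_real plus_complex.sel minus_complex.sel) simp
  then show "b2 * sqrt N * Re (acoustic_root (Complex 0 \<xi>) w) = Re S"
    using b2_pos sN by simp
qed

text \<open>A critical root is \<open>\<i> * \<delta>\<close>, so \<open>S\<close> is imaginary and
  \<open>M * \<bar>\<tau>\<bar>\<close> is at least \<open>G * \<bar>w\<bar>\<close>. This bounds
  \<open>\<delta>\<close> from below, up to the shift by \<open>b2 * (w * h)\<close>, while
  criticality fixes its square.\<close>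

lemma critical_root_bound:
  assumes nz: "\<xi> \<noteq> 0 \<or> w \<noteq> 0"
    and crit: "of_real b2 * (acoustic_root (Complex 0 \<xi>) w)\<^sup>2 = of_real (w\<^sup>2 * Q)"
  shows "(M * G - b2 * \<bar>h\<bar>)\<^sup>2 \<le> - b2 * N\<^sup>2 * Q"
proof -
  define S where "S = root_discriminant (Complex 0 \<xi>) w"
  define \<tau> where "\<tau> = N * \<xi> - w * h"
  define \<delta> where "\<delta> = Im (acoustic_root (Complex 0 \<xi>) w)"
  note root = acoustic_root_imaginary_frequency[where \<xi> = \<xi> and w = w, folded S_def \<tau>_def \<delta>_def]
  have re: "Re (acoustic_root (Complex 0 \<xi>) w) = 0"
    using Re_critical_root[OF _ crit] by simp
  then have "acoustic_root (Complex 0 \<xi>) w = \<i> * of_real \<delta>"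
    by (simp add: complex_eq_iff \<delta>_def)
  then have "complex_of_real (w\<^sup>2 * Q) = of_real (- (b2 * \<delta>\<^sup>2))"
    using crit by (simp only: power_mult_distrib i_squared) simp
  then have wQ: "w\<^sup>2 * Q = - (b2 * \<delta>\<^sup>2)" by (simp only: of_real_eq_iff)
  have "Re S = 0" using root(3) re by simp
  then have "(Im S)\<^sup>2 = M\<^sup>2 * \<tau>\<^sup>2 - G\<^sup>2 * w\<^sup>2"
    using arg_cong[OF root(1), of Re] by (simp add: Re_power2)
  moreover have "0 \<le> (Im S)\<^sup>2" by simp
  ultimately have "G\<^sup>2 * w\<^sup>2 \<le> M\<^sup>2 * \<tau>\<^sup>2" by linarith
  then have "(G * \<bar>w\<bar>)\<^sup>2 \<le> (M * \<bar>\<tau>\<bar>)\<^sup>2" by (simp add: power_mult_distrib)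
  then have G\<tau>: "G * \<bar>w\<bar> \<le> M * \<bar>\<tau>\<bar>" by (rule power2_le_imp_le) (use M_pos in simp)
  have sN: "0 < sqrt N" using N_pos by simp
  \<comment> \<open>\<open>Im S\<close> has the sign of \<open>\<tau>\<close> or vanishes, so the
    two terms reinforce each other.\<close>
  have abs: "M\<^sup>2 * \<bar>\<tau>\<bar> \<le> \<bar>b2 * N * \<delta> + b2 * (w * h)\<bar>"
  proof (cases "0 \<le> \<tau>")
    case True
    then have "0 \<le> sqrt N * Im S" using root(4) G\<tau> sN by simp
    then show ?thesis using root(2) True by linarith
  next
    case False
    then have "sqrt N * Im S \<le> 0" using root(5) G\<tau> sN by (simp add: mult_le_0_iff)
    moreover have "M\<^sup>2 * \<bar>\<tau>\<bar> = - (M\<^sup>2 * \<tau>)" using False by simp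
    ultimately show ?thesis using root(2) by linarith
  qed
  have "w \<noteq> 0"
  proof
    assume "w = 0"
    then have "\<delta> = 0" using wQ b2_pos by simp
    then have "\<tau> = 0" using abs \<open>w = 0\<close> M_pos by (simp add: mult_le_0_iff)
    then show False using nz \<open>w = 0\<close> N_pos by (simp add: \<tau>_def)
  qed
  have "M * (G * \<bar>w\<bar>) \<le> M * (M * \<bar>\<tau>\<bar>)" using G\<tau> M_pos by (intro mult_left_mono) auto
  also have "\<dots> \<le> \<bar>b2 * N * \<delta> + b2 * (w * h)\<bar>" using abs by (simp only: power2_eq_square mult.assoc)
  also have "\<dots> \<le> \<bar>b2 * N * \<delta>\<bar> + \<bar>b2 * (w * h)\<bar>" by (rule abs_triangle_ineq)
  also have "\<bar>b2 * (w * h)\<bar> = b2 * \<bar>h\<bar> * \<bar>w\<bar>" using b2_pos by (simp add: abs_mult)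
  finally have "(M * G - b2 * \<bar>h\<bar>) * \<bar>w\<bar> \<le> \<bar>b2 * N * \<delta>\<bar>" by (simp only: algebra_simps)
  moreover have "0 \<le> M * G - b2 * \<bar>h\<bar>" using h_less_G by simp
  ultimately have "((M * G - b2 * \<bar>h\<bar>) * \<bar>w\<bar>)\<^sup>2 \<le> \<bar>b2 * N * \<delta>\<bar>\<^sup>2"
    by (intro power_mono mult_nonneg_nonneg) auto
  also have "\<bar>b2 * N * \<delta>\<bar>\<^sup>2 = b2 * N\<^sup>2 * (b2 * \<delta>\<^sup>2)" unfolding power2_abs by (simp only: power2_eq_square mult_ac)
  also have "b2 * \<delta>\<^sup>2 = - (w\<^sup>2 * Q)" using wQ by linarith
  also have "b2 * N\<^sup>2 * - (w\<^sup>2 * Q) = (- b2 * N\<^sup>2 * Q) * w\<^sup>2"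
    by (simp only: mult_minus_left mult_minus_right mult_ac)
  finally have "(M * G - b2 * \<bar>h\<bar>)\<^sup>2 * w\<^sup>2 \<le> (- b2 * N\<^sup>2 * Q) * w\<^sup>2"
    by (simp only: power_mult_distrib power2_abs)
  then show ?thesis using \<open>w \<noteq> 0\<close> by (simp only: mult_le_cancel_right) auto
qed

text \<open>The converse bound: the intermediate value theorem supplies a frequency at which the
  root takes the critical value.\<close>

lemma critical_root_exists:
  assumes ineq: "(M * G - b2 * \<bar>h\<bar>)\<^sup>2 \<le> - b2 * N\<^sup>2 * Q"
  obtains \<xi> w where "w \<noteq> 0"
    "of_real b2 * (acoustic_root (Complex 0 \<xi>) w)\<^sup>2 = of_real (w\<^sup>2 * Q)"
proof -
  \<comment> \<open>This sign of \<open>w\<close> makes the shift by \<open>b2 * (w * h)\<close>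
    work in favour of the inequality \<open>E\<close>.\<close>
  define w :: real where "w = (if 0 \<le> h then 1 else -1)"
  have w: "w * h = \<bar>h\<bar>" "\<bar>w\<bar> = 1" "w\<^sup>2 = 1" by (simp_all add: w_def)
  have "0 < (M * G - b2 * \<bar>h\<bar>)\<^sup>2" using h_less_G by simp
  then have "0 < b2 * N\<^sup>2 * (- Q)" using ineq by linarith
  moreover have "0 < b2 * N\<^sup>2" using b2_pos N_pos by (intro mult_pos_pos zero_less_power)
  ultimately have "0 < - Q" by (rule zero_less_mult_pos)
  then have Q: "Q < 0" by simp
  define \<delta> where "\<delta> = sqrt (- Q / b2)"
  have "0 \<le> - Q / b2" using Q b2_pos by (intro divide_nonneg_pos) simp_all
  then have "0 \<le> \<delta>" "\<delta>\<^sup>2 = - Q / b2" by (simp_all only: \<delta>_def real_sqrt_ge_zero real_sqrt_pow2)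
  then have \<delta>2: "b2 * \<delta>\<^sup>2 = - Q" using b2_pos by simp
  have "(M * G - b2 * \<bar>h\<bar>)\<^sup>2 \<le> (b2 * N * \<delta>)\<^sup>2"
  proof -
    have "(b2 * N * \<delta>)\<^sup>2 = b2 * N\<^sup>2 * (b2 * \<delta>\<^sup>2)" by (simp only: power2_eq_square mult_ac)
    then show ?thesis using ineq unfolding \<delta>2 by (simp only: mult_minus_left mult_minus_right)
  qed
  moreover have "0 \<le> b2 * N * \<delta>"
    using \<open>0 \<le> \<delta>\<close> less_imp_le[OF b2_pos] less_imp_le[OF N_pos] by (intro mult_nonneg_nonneg)
  ultimately have "M * G - b2 * \<bar>h\<bar> \<le> b2 * N * \<delta>" by (rule power2_le_imp_le)
  then have E: "M * G \<le> b2 * N * \<delta> + b2 * \<bar>h\<bar>" (is "_ \<le> ?E") by linarith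
  \<comment> \<open>\<open>f\<close> is \<open>M^2 * \<tau> + sqrt N * Im S\<close> on the branch
    with \<open>Im S \<ge> 0\<close>; by the root formula \<open>f \<tau> = ?E\<close> means that
    the imaginary part of the root is \<open>\<delta>\<close>.\<close>
  define f where "f \<tau> = M\<^sup>2 * \<tau> + sqrt N * sqrt (M\<^sup>2 * \<tau>\<^sup>2 - G\<^sup>2)" for \<tau>
  have "\<exists>\<tau>. G / M \<le> \<tau> \<and> \<tau> \<le> ?E / M\<^sup>2 \<and> f \<tau> = ?E"
  \<comment> \<open>At the left end the radical vanishes and \<open>f\<close> equals
    \<open>M * G\<close>; at the right end the linear term alone equals \<open>?E\<close>.\<close>
  proof (rule IVT')
    show "f (G / M) \<le> ?E"
      unfolding f_def using M_pos E by (simp add: power_divide power2_eq_square)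
    have "M * G / M\<^sup>2 \<le> ?E / M\<^sup>2" using E by (intro divide_right_mono) auto
    then show le: "G / M \<le> ?E / M\<^sup>2" using M_pos by (simp add: power2_eq_square)
    have "G \<le> M * (?E / M\<^sup>2)"
      using mult_left_mono[OF le, of M] M_pos by simp
    then have "G\<^sup>2 \<le> (M * (?E / M\<^sup>2))\<^sup>2" using G_pos by (intro power_mono) auto
    then have "0 \<le> sqrt N * sqrt (M\<^sup>2 * (?E / M\<^sup>2)\<^sup>2 - G\<^sup>2)"
      by (simp only: power_mult_distrib) simp
    moreover have "M\<^sup>2 * (?E / M\<^sup>2) = ?E" using M_pos by simp
    ultimately show "?E \<le> f (?E / M\<^sup>2)" unfolding f_def by linarith
    show "continuous_on {G / M..?E / M\<^sup>2} f"
      unfolding f_def by (intro continuous_intros)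
  qed
  then obtain \<tau> where \<tau>: "G / M \<le> \<tau>" "f \<tau> = ?E" by blast
  define \<xi> where "\<xi> = (\<tau> + w * h) / N"
  define S where "S = root_discriminant (Complex 0 \<xi>) w"
  have "N * \<xi> - w * h = \<tau>" using N_pos by (simp add: \<xi>_def)
  note root = acoustic_root_imaginary_frequency[where \<xi> = \<xi> and w = w, folded S_def, unfolded this]
  have G\<tau>: "G \<le> M * \<tau>" using \<tau>(1) M_pos by (simp add: pos_divide_le_eq mult.commute)
  then have "G\<^sup>2 \<le> (M * \<tau>)\<^sup>2" using G_pos by (intro power_mono) auto
  then have r: "0 \<le> M\<^sup>2 * \<tau>\<^sup>2 - G\<^sup>2" by (simp add: power_mult_distrib)
  have re: "(Re S)\<^sup>2 - (Im S)\<^sup>2 = G\<^sup>2 - M\<^sup>2 * \<tau>\<^sup>2"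
    using arg_cong[OF root(1), of Re] w by (simp add: Re_power2)
  have im: "Re S * Im S = 0"
    using arg_cong[OF root(1), of Im] by (simp add: Im_power2)
  have "Re S = 0"
  proof (rule ccontr)
    assume "Re S \<noteq> 0"
    then have "(Im S)\<^sup>2 = 0" "0 < (Re S)\<^sup>2" using im by simp_all
    then show False using re r by linarith
  qed
  \<comment> \<open>The modulus comes from the square of \<open>S\<close>; \<open>root(4)\<close>
    selects the nonnegative sign.\<close>
  then have ImS: "Im S = sqrt (M\<^sup>2 * \<tau>\<^sup>2 - G\<^sup>2)"
    using re root(4) w G\<tau> by (intro real_sqrt_unique[symmetric]) auto
  have "b2 * N * Im (acoustic_root (Complex 0 \<xi>) w) = b2 * N * \<delta>"
    using root(2)[unfolded w(1) ImS] \<tau>(2)[unfolded f_def] by linarith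
  then have "Im (acoustic_root (Complex 0 \<xi>) w) = \<delta>" using b2_pos N_pos by (simp only: mult_cancel_left) auto
  moreover have "Re (acoustic_root (Complex 0 \<xi>) w) = 0"
    using root(3) \<open>Re S = 0\<close> b2_pos N_pos by simp
  ultimately have "acoustic_root (Complex 0 \<xi>) w = \<i> * of_real \<delta>"
    by (simp add: complex_eq_iff)
  then have "of_real b2 * (acoustic_root (Complex 0 \<xi>) w)\<^sup>2 = - of_real (b2 * \<delta>\<^sup>2)"
    by (simp only: power_mult_distrib i_squared) simp
  then have "of_real b2 * (acoustic_root (Complex 0 \<xi>) w)\<^sup>2 = of_real (w\<^sup>2 * Q)"
    unfolding \<delta>2 w by simp
  then show ?thesis using that[of w \<xi>] w by auto
qed

text \<open>Zeros with \<open>\<eta> > 0\<close> are already excluded, so the two preceding lemmas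
  decide. For \<open>Q \<ge> 0\<close> the inequality holds automatically by
  \<open>h_less_G\<close>.\<close>

lemma uniform_lopatinski_iff:
  "uniform_lopatinski_condition M R F \<longleftrightarrow> - b2 * N\<^sup>2 * Q < (M * G - b2 * \<bar>h\<bar>)\<^sup>2"
proof
  assume U: "uniform_lopatinski_condition M R F"
  show "- b2 * N\<^sup>2 * Q < (M * G - b2 * \<bar>h\<bar>)\<^sup>2"
  proof (rule ccontr)
    assume "\<not> ?thesis"
    then obtain \<xi> w where w: "w \<noteq> 0"
      and "of_real b2 * (acoustic_root (Complex 0 \<xi>) w)\<^sup>2 = of_real (w\<^sup>2 * Q)"
      using critical_root_exists by (metis not_le)
    moreover have "0\<^sup>2 + \<xi>\<^sup>2 + w\<^sup>2 \<noteq> 0" using w by (simp add: sum_power2_eq_zero_iff)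
    ultimately have "det (lopatinski_matrix M R F 0 \<xi> w) = 0"
      using det_lopatinski_matrix_eq_0_iff[of 0 \<xi> w] by blast
    then show False
      using U \<open>0\<^sup>2 + \<xi>\<^sup>2 + w\<^sup>2 \<noteq> 0\<close> unfolding uniform_lopatinski_condition_def by (metis order.refl)
  qed
next
  assume less: "- b2 * N\<^sup>2 * Q < (M * G - b2 * \<bar>h\<bar>)\<^sup>2"
  show "uniform_lopatinski_condition M R F"
    unfolding uniform_lopatinski_condition_def
  proof (intro allI impI notI)
    fix \<eta> \<xi> w :: real
    assume "\<eta> \<ge> 0 \<and> \<eta>\<^sup>2 + \<xi>\<^sup>2 + w\<^sup>2 \<noteq> 0" and "det (lopatinski_matrix M R F \<eta> \<xi> w) = 0"
    moreover from this have "\<eta> = 0"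
      using lopatinski unfolding lopatinski_condition_def by (metis less_eq_real_def)
    ultimately have "\<xi> \<noteq> 0 \<or> w \<noteq> 0"
      "of_real b2 * (acoustic_root (Complex 0 \<xi>) w)\<^sup>2 = of_real (w\<^sup>2 * Q)"
      using det_lopatinski_matrix_eq_0_iff[of \<eta> \<xi> w] by auto
    then show False using critical_root_bound less by (meson not_le)
  qed
qed

text \<open>Since \<open>G^2 = b2 * \<Delta>\<close>, expanding the square produces a common factor
  \<open>b2 > 0\<close>, which is cancelled.\<close>

lemma stability_inequality_iff:
  "- b2 * N\<^sup>2 * Q < (M * G - b2 * \<bar>h\<bar>)\<^sup>2 \<longleftrightarrow>
    2 * M * \<bar>h\<bar> * G < (N + M\<^sup>2) * \<Delta> - (R * (M\<^sup>2 - m) + n) * N\<^sup>2 + h\<^sup>2 * (2 * N - M\<^sup>2)"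
proof -
  have "(M * G - b2 * \<bar>h\<bar>)\<^sup>2 = M\<^sup>2 * G\<^sup>2 - 2 * M * b2 * \<bar>h\<bar> * G + b2\<^sup>2 * \<bar>h\<bar>\<^sup>2"
    by (simp only: power2_diff power_mult_distrib) simp
  also have "\<dots> = b2 * (M\<^sup>2 * \<Delta> - 2 * M * \<bar>h\<bar> * G + b2 * h\<^sup>2)"
    unfolding G_sq power2_abs by algebra
  finally have "- b2 * N\<^sup>2 * Q < (M * G - b2 * \<bar>h\<bar>)\<^sup>2 \<longleftrightarrow>
    b2 * (- (N\<^sup>2 * Q)) < b2 * (M\<^sup>2 * \<Delta> - 2 * M * \<bar>h\<bar> * G + b2 * h\<^sup>2)"
    by (simp only: mult_minus_left mult_minus_right mult.assoc)
  also have "\<dots> \<longleftrightarrow> - (N\<^sup>2 * Q) < M\<^sup>2 * \<Delta> - 2 * M * \<bar>h\<bar> * G + b2 * h\<^sup>2"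
    using b2_pos by (rule mult_less_cancel_left_pos)
  also have "\<dots> \<longleftrightarrow> 2 * M * \<bar>h\<bar> * G < M\<^sup>2 * \<Delta> + b2 * h\<^sup>2 + N\<^sup>2 * Q"
    by linarith
  also have "M\<^sup>2 * \<Delta> + b2 * h\<^sup>2 + N\<^sup>2 * Q
    = (N + M\<^sup>2) * \<Delta> - (R * (M\<^sup>2 - m) + n) * N\<^sup>2 + h\<^sup>2 * (2 * N - M\<^sup>2)"
    unfolding Q_def by algebra
  finally show ?thesis .
qed

text \<open>Again Lagrange's identity for the rows of \<open>F\<close>.\<close>

lemma \<Delta>_eq: "1 + (\<Sum>i\<in>UNIV. \<Sum>j\<in>UNIV. (F$i$j)\<^sup>2) + (det F)\<^sup>2 = \<Delta>"
  unfolding sum_2 det_2 by algebra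

end

theorem theorem2p1:
  fixes P :: "real set" and \<rho> :: "real \<Rightarrow> real" and Um Up :: fluid_state
    and M Mm R :: real and \<F> :: "real^2^2"
  assumes "rectilinear_shock P \<rho> Um Up"
    and "M = mach \<rho> Up" and "Mm = mach \<rho> Um"
    and "R = density_ratio \<rho> Um Up" and "\<F> = scaled_defgrad \<rho> Up"
    and "Mm > M / sqrt (M\<^sup>2 - (M_one \<F>)\<^sup>2)" and "M_one \<F> < M" and "M < M_star \<F>"
  shows
    "let FF = (\<Sum>i\<in>UNIV. \<Sum>j\<in>UNIV. (\<F>$i$j)\<^sup>2);
         stability_inequality =
           (1 + (\<F>$1$1)\<^sup>2 + (\<F>$1$2)\<^sup>2 + M\<^sup>2) * (1 + FF + (det \<F>)\<^sup>2)
           - (R * (M\<^sup>2 - (\<F>$1$1)\<^sup>2 - (\<F>$1$2)\<^sup>2) + (\<F>$2$1)\<^sup>2 + (\<F>$2$2)\<^sup>2)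
               * (1 + (\<F>$1$1)\<^sup>2 + (\<F>$1$2)\<^sup>2)\<^sup>2
           + (\<F>$1$1 * \<F>$2$1 + \<F>$1$2 * \<F>$2$2)\<^sup>2
               * (2 * (1 + (\<F>$1$1)\<^sup>2 + (\<F>$1$2)\<^sup>2) - M\<^sup>2)
           > 2 * M * \<bar>\<F>$1$1 * \<F>$2$1 + \<F>$1$2 * \<F>$2$2\<bar>
               * sqrt ((1 + (\<F>$1$1)\<^sup>2 + (\<F>$1$2)\<^sup>2 - M\<^sup>2) * (1 + FF + (det \<F>)\<^sup>2))
     in (uniformly_stable \<rho> Um Up \<longleftrightarrow> stability_inequality) \<and>
        (\<not> stability_inequality \<longrightarrow> weakly_stable \<rho> Um Up)"
proof -
  have "0 < R"
    using assms(1,4) by (auto simp: rectilinear_shock_def equation_of_state_def density_ratio_def)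
  then interpret shock_data M R \<F>
    using assms(7,8) by (rule shock_data.intro)
  \<comment> \<open>Regroups the polynomials of the statement into the abbreviations of the
    locale.\<close>
  have *: "M\<^sup>2 - (\<F>$1$1)\<^sup>2 - (\<F>$1$2)\<^sup>2 = M\<^sup>2 - m" "1 + (\<F>$1$1)\<^sup>2 + (\<F>$1$2)\<^sup>2 = N"
    "R * (M\<^sup>2 - m) + (\<F>$2$1)\<^sup>2 + (\<F>$2$2)\<^sup>2 = R * (M\<^sup>2 - m) + n"
    by simp_all
  show ?thesis
    unfolding Let_def uniformly_stable_def weakly_stable_def assms(2,4,5)[symmetric]
      \<Delta>_eq * G_def[symmetric] uniform_lopatinski_iff stability_inequality_iff
    using lopatinski by blast
qed

end
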